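(* For a regular topological space $X$ the following conditions are equivalent: (1) $X$ is an $\aleph_0$-space; (2) $X$ is the image of a metrizable separable space $M$ under a subproper map $\pi:M\to X$; (3) $X$ is a $k^*$-metrizable space with countable network; (4) $X$ is a $\mathrm{cs}^*$-metrizable space with countable network; (5) the $k$-coreflexion $kX$ of $X$ is a $k^*$-metrizable space with countable extent; (6) the sequential coreflexion $sX$ of $X$ is a $\mathrm{cs}^*$-metrizable space with countable extent; (7) $kX$ is the image of a metrizable separable space $M$ under a quotient map $f:M\to kX$. If $sX$ is regular and the Continuum Hypothesis holds, then the conditions (1)--(6) are equivalent to: (8) $sX$ is separable and $\mathrm{cs}^*$-metrizable.
   Context: All topological spaces are Hausdorff; "map" means continuous function. A subset is precompact if its closure is compact. A map $f:M\to X$ is subproper if there is $Z\subset M$ with $f(Z)=X$ such that $Z\cap f^{-1}(K)$ is precompact in $M$ for every precompact $K\subset X$. A space is $k^*$-metrizable if it is the image of a metrizable space under a subproper map. A section of a map $f:X\to Y$ is a (possibly discontinuous) function $s:Y\to X$ with $f\circ s=\mathrm{id}_Y$. A function $s:Y\to X$ is $\mathrm{cs}^*$-continuous if for every convergent sequence $(y_n)$ in $Y$ the sequence $(s(y_n))$ has an accumulation point in $X$ (a point each of whose neighborhoods contains $s(y_n)$ for infinitely many $n$). A space $X$ is $\mathrm{cs}^*$-metrizable if it is the image of a metrizable space $M$ under a map $\pi:M\to X$ having a $\mathrm{cs}^*$-continuous section. A network for $X$ is a family $\mathcal N$ of subsets such that for every open $U$ and $x\in U$ there is $N\in\mathcal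 N$ with $x\in N\subset U$. A $k$-network is a family $\mathcal N$ of subsets such that for every open $U$ and compact $K\subset U$ there is a finite $\mathcal F\subset\mathcal N$ with $K\subset\bigcup\mathcal F\subset U$. An $\aleph_0$-space is a regular space with a countable $k$-network. A space has countable extent if all its closed discrete subspaces are countable. The $k$-coreflexion $kX$ is the set $X$ with the strongest topology inducing the original topology on each compact subset of $X$. The sequential coreflexion $sX$ is the set $X$ with the topology of all sequentially open subsets of $X$; a set is sequentially open if its complement is sequentially closed, i.e. contains the limits of all its sequences that converge in $X$. *)

theory Defs
  imports "HOL-Analysis.Analysis"
begin

text \<open>All spaces of the source are Hausdorff. This is made explicit wherever it is not automatic:
  in the definitions of the classes of spaces below and in the hypotheses of the theorem
  (metrizable spaces are Hausdorff, and so are the two coreflexions of a Hausdorff space, see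
  \<open>Hausdorff_kification\<close> and \<open>Hausdorff_seq_coreflexion\<close>).\<close>

definition precompact_in :: "'a topology \<Rightarrow> 'a set \<Rightarrow> bool" where
  "precompact_in X K \<longleftrightarrow> K \<subseteq> topspace X \<and> compactin X (X closure_of K)"

definition subproper_map :: "'b topology \<Rightarrow> 'a topology \<Rightarrow> ('b \<Rightarrow> 'a) \<Rightarrow> bool" where
  "subproper_map M X f \<longleftrightarrow>
     continuous_map M X f \<and>
     (\<exists>Z. Z \<subseteq> topspace M \<and> f ` Z = topspace X \<and>
          (\<forall>K. precompact_in X K \<longrightarrow> precompact_in M (Z \<inter> {z \<in> topspace M. f z \<in> K})))"

definition section_of :: "'b topology \<Rightarrow> 'a topology \<Rightarrow> ('b \<Rightarrow> 'a) \<Rightarrow> ('a \<Rightarrow> 'b) \<Rightarrow> bool" where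
  "section_of X Y f s \<longleftrightarrow> s ` topspace Y \<subseteq> topspace X \<and> (\<forall>y \<in> topspace Y. f (s y) = y)"

definition accumulation_point :: "'a topology \<Rightarrow> (nat \<Rightarrow> 'a) \<Rightarrow> 'a \<Rightarrow> bool" where
  "accumulation_point X x p \<longleftrightarrow>
     p \<in> topspace X \<and> (\<forall>U. openin X U \<and> p \<in> U \<longrightarrow> infinite {n. x n \<in> U})"

definition cs_star_continuous :: "'a topology \<Rightarrow> 'b topology \<Rightarrow> ('a \<Rightarrow> 'b) \<Rightarrow> bool" where
  "cs_star_continuous Y X s \<longleftrightarrow>
     s ` topspace Y \<subseteq> topspace X \<and>
     (\<forall>y. range y \<subseteq> topspace Y \<and> (\<exists>l. limitin Y y l sequentially)
          \<longrightarrow> (\<exists>p. accumulation_point X (\<lambda>n. s (y n)) p))"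

text \<open>In the next two definitions the metrizable space ranges over topologies on subsets of the type
  \<open>nat \<Rightarrow> 'a\<close>, because HOL cannot quantify over types. This is no restriction: a metrizable space
  can be shrunk to the closure of the image of a section, each point of which is the limit of a
  sequence indexed by points of \<open>X\<close>. The lemmas \<open>k_star_metrizableI\<close> and \<open>cs_star_metrizableI\<close>
  below allow metrizable spaces over arbitrary types.\<close>

definition k_star_metrizable :: "'a topology \<Rightarrow> bool" where
  "k_star_metrizable X \<longleftrightarrow>
     Hausdorff_space X \<and>
     (\<exists>(M :: (nat \<Rightarrow> 'a) topology) \<pi>.
        metrizable_space M \<and> subproper_map M X \<pi> \<and> \<pi> ` topspace M = topspace X)"

definition cs_star_metrizable :: "'a topology \<Rightarrow> bool" where
  "cs_star_metrizable X \<longleftrightarrow>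
     Hausdorff_space X \<and>
     (\<exists>(M :: (nat \<Rightarrow> 'a) topology) \<pi>.
        metrizable_space M \<and> continuous_map M X \<pi> \<and> \<pi> ` topspace M = topspace X \<and>
        (\<exists>s. section_of M X \<pi> s \<and> cs_star_continuous X M s))"

definition is_network :: "'a topology \<Rightarrow> 'a set set \<Rightarrow> bool" where
  "is_network X \<N> \<longleftrightarrow>
     \<N> \<subseteq> Pow (topspace X) \<and>
     (\<forall>U x. openin X U \<and> x \<in> U \<longrightarrow> (\<exists>N \<in> \<N>. x \<in> N \<and> N \<subseteq> U))"

definition is_k_network :: "'a topology \<Rightarrow> 'a set set \<Rightarrow> bool" where
  "is_k_network X \<N> \<longleftrightarrow>
     \<N> \<subseteq> Pow (topspace X) \<and>
     (\<forall>U K. openin X U \<and> compactin X K \<and> K \<subseteq> U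
        \<longrightarrow> (\<exists>\<F>. finite \<F> \<and> \<F> \<subseteq> \<N> \<and> K \<subseteq> \<Union>\<F> \<and> \<Union>\<F> \<subseteq> U))"

definition has_countable_network :: "'a topology \<Rightarrow> bool" where
  "has_countable_network X \<longleftrightarrow> (\<exists>\<N>. countable \<N> \<and> is_network X \<N>)"

definition aleph0_space :: "'a topology \<Rightarrow> bool" where
  "aleph0_space X \<longleftrightarrow>
     Hausdorff_space X \<and> regular_space X \<and> (\<exists>\<N>. countable \<N> \<and> is_k_network X \<N>)"

definition countable_extent :: "'a topology \<Rightarrow> bool" where
  "countable_extent X \<longleftrightarrow>
     (\<forall>D. closedin X D \<and> subtopology X D = discrete_topology D \<longrightarrow> countable D)"

definition seq_closed_in :: "'a topology \<Rightarrow> 'a set \<Rightarrow> bool" where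
  "seq_closed_in X A \<longleftrightarrow>
     A \<subseteq> topspace X \<and>
     (\<forall>x l. range x \<subseteq> A \<and> limitin X x l sequentially \<longrightarrow> l \<in> A)"

definition seq_open_in :: "'a topology \<Rightarrow> 'a set \<Rightarrow> bool" where
  "seq_open_in X U \<longleftrightarrow> U \<subseteq> topspace X \<and> seq_closed_in X (topspace X - U)"

definition seq_coreflexion :: "'a topology \<Rightarrow> 'a topology" where
  "seq_coreflexion X = topology (seq_open_in X)"

definition continuum_hypothesis :: bool where
  "continuum_hypothesis \<longleftrightarrow> (\<forall>A :: real set. countable A \<or> A \<approx> (UNIV :: real set))"


text \<open>The $k$-coreflexion is the library's \<^const>\<open>kification\<close>. It induces the original topology on
  each compact set by \<open>subtopology_kification_compact\<close>, and it is the strongest such topology.\<close>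

lemma kification_strongest:
  assumes "topspace T = topspace X"
    and "\<And>K. compactin X K \<Longrightarrow> subtopology T K = subtopology X K"
    and "openin T U"
  shows "openin (kification X) U"
  unfolding openin_kification
proof (intro conjI allI impI)
  show "U \<subseteq> topspace X"
    using assms openin_subset by metis
  fix K assume "compactin X K"
  then show "openin (subtopology X K) (K \<inter> U)"
    using assms(2)[of K] assms(3) openin_subtopology_Int2[of T U K] by simp
qed

lemma Hausdorff_kification:
  assumes "Hausdorff_space X"
  shows "Hausdorff_space (kification X)"
  using assms unfolding Hausdorff_space_def
  by (metis openin_kification_finer topspace_kification)

lemma istopology_seq_open_in: "istopology (seq_open_in X)"
  unfolding istopology_def
proof (intro conjI allI impI)
  fix S T assume S: "seq_open_in X S" and T: "seq_open_in X T"
  show "seq_open_in X (S \<inter> T)"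
    unfolding seq_open_in_def seq_closed_in_def
  proof (intro conjI allI impI)
    show "S \<inter> T \<subseteq> topspace X"
      using S by (auto simp: seq_open_in_def)
    fix x l assume A: "range x \<subseteq> topspace X - S \<inter> T \<and> limitin X x l sequentially"
    show "l \<in> topspace X - S \<inter> T"
    proof (rule ccontr)
      assume "l \<notin> topspace X - S \<inter> T"
      then have l: "l \<in> S" "l \<in> T"
        using A limitin_topspace by fastforce+
      have key: "finite {n. x n \<notin> W}" if W: "seq_open_in X W" "l \<in> W" for W
      proof (rule ccontr)
        assume inf: "infinite {n. x n \<notin> W}"
        define r where "r = enumerate {n. x n \<notin> W}"
        have r: "strict_mono r"
          using inf strict_mono_enumerate unfolding r_def by blast
        have "x (r n) \<notin> W" for n
          using enumerate_in_set[OF inf, of n] by (simp add: r_def)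
        then have "range (x \<circ> r) \<subseteq> topspace X - W"
          using A by auto
        moreover have "limitin X (x \<circ> r) l sequentially"
          by (rule limitin_subsequence[OF r conjunct2[OF A]])
        moreover have "\<forall>y m. range y \<subseteq> topspace X - W \<and> limitin X y m sequentially
            \<longrightarrow> m \<in> topspace X - W"
          using W(1) unfolding seq_open_in_def seq_closed_in_def by simp
        ultimately have "l \<in> topspace X - W"
          by metis
        then show False
          using W(2) by simp
      qed
      have "(UNIV :: nat set) \<subseteq> {n. x n \<notin> S} \<union> {n. x n \<notin> T}"
        using A by auto
      then have "finite (UNIV :: nat set)"
        by (rule finite_subset) (intro finite_UnI key[OF S l(1)] key[OF T l(2)])
      then show False
        by simp
    qed
  qed auto
next
  fix \<K> assume K: "\<forall>K\<in>\<K>. seq_open_in X K"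
  show "seq_open_in X (\<Union>\<K>)"
    unfolding seq_open_in_def seq_closed_in_def
  proof (intro conjI allI impI)
    show "\<Union>\<K> \<subseteq> topspace X"
      using K by (auto simp: seq_open_in_def)
    fix x l assume A: "range x \<subseteq> topspace X - \<Union>\<K> \<and> limitin X x l sequentially"
    have "l \<notin> K" if "K \<in> \<K>" for K
    proof -
      have "seq_closed_in X (topspace X - K)"
        using K that by (simp add: seq_open_in_def)
      then have "range x \<subseteq> topspace X - K \<and> limitin X x l sequentially \<longrightarrow> l \<in> topspace X - K"
        by (simp add: seq_closed_in_def)
      moreover have "range x \<subseteq> topspace X - K"
        using A that by auto
      ultimately show ?thesis
        using A by simp
    qed
    then show "l \<in> topspace X - \<Union>\<K>"
      using conjunct2[OF A] limitin_topspace[of X x l sequentially] by simp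
  qed auto
qed

lemma openin_seq_coreflexion: "openin (seq_coreflexion X) U \<longleftrightarrow> seq_open_in X U"
  by (simp add: seq_coreflexion_def istopology_seq_open_in)

lemma openin_seq_coreflexion_finer:
  assumes "openin X U"
  shows "openin (seq_coreflexion X) U"
  unfolding openin_seq_coreflexion seq_open_in_def seq_closed_in_def
proof (intro conjI allI impI)
  show "U \<subseteq> topspace X"
    using assms by (rule openin_subset)
  fix x l assume A: "range x \<subseteq> topspace X - U \<and> limitin X x l sequentially"
  have "l \<notin> U"
  proof
    assume "l \<in> U"
    then have "eventually (\<lambda>n. x n \<in> U) sequentially"
      using A assms limitinD by metis
    then obtain n where "x n \<in> U"
      using eventually_happens' sequentially_bot by blast
    then show False
      using A by auto
  qed
  then show "l \<in> topspace X - U"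
    using A limitin_topspace by fastforce
qed auto

lemma topspace_seq_coreflexion [simp]: "topspace (seq_coreflexion X) = topspace X"
proof (rule antisym)
  show "topspace (seq_coreflexion X) \<subseteq> topspace X"
    using openin_topspace[of "seq_coreflexion X"]
    unfolding openin_seq_coreflexion seq_open_in_def by simp
  show "topspace X \<subseteq> topspace (seq_coreflexion X)"
    by (simp add: openin_seq_coreflexion_finer openin_subset)
qed

lemma Hausdorff_seq_coreflexion:
  assumes "Hausdorff_space X"
  shows "Hausdorff_space (seq_coreflexion X)"
  using assms unfolding Hausdorff_space_def
  by (metis openin_seq_coreflexion_finer topspace_seq_coreflexion)


text \<open>The following lemmas show that the carrier types chosen for the metrizable spaces, \<open>nat \<Rightarrow> 'a\<close>
  above and \<open>nat \<Rightarrow> nat\<close> for separable ones, lose no generality.\<close>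

lemma metrizable_retype:
  fixes M :: "'b topology" and h :: "'d \<Rightarrow> 'b"
  assumes M: "metrizable_space M" and dense: "M closure_of (h ` D) = topspace M"
  shows "\<exists>(N :: (nat \<Rightarrow> 'd) topology) g. homeomorphic_map N M g"
proof -
  obtain A d where Ad: "Metric_space A d" "M = Metric_space.mtopology A d"
    using M unfolding metrizable_space_def by blast
  have "\<exists>\<sigma>. limitin M (\<lambda>n. h (\<sigma> n)) p sequentially" if "p \<in> topspace M" for p
  proof -
    have "p \<in> M closure_of (h ` D)"
      using that dense by simp
    then obtain \<tau> where \<tau>: "range \<tau> \<subseteq> h ` D" "limitin M \<tau> p sequentially"
      using Metric_space.closure_of_sequentially[OF Ad(1), of "h ` D"] Ad(2) by auto
    then have "\<forall>n. \<exists>x. \<tau> n = h x"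
      by blast
    then obtain \<sigma> where "\<forall>n. \<tau> n = h (\<sigma> n)"
      by metis
    then have "\<tau> = (\<lambda>n. h (\<sigma> n))"
      by auto
    then show ?thesis
      using \<tau>(2) by blast
  qed
  then obtain e where e: "\<And>p. p \<in> topspace M \<Longrightarrow> limitin M (\<lambda>n. h (e p n)) p sequentially"
    by metis
  have inj: "inj_on e (topspace M)"
  proof (rule inj_onI)
    fix p q assume "p \<in> topspace M" "q \<in> topspace M" "e p = e q"
    then show "p = q"
      using e[of p] e[of q] limitin_Hausdorff_unique[OF _ _ _ metrizable_imp_Hausdorff_space[OF M]]
      by (metis sequentially_bot)
  qed
  define g where "g = inv_into (topspace M) e"
  define N where "N = pullback_topology (e ` topspace M) g M"
  have ge: "g (e p) = p" if "p \<in> topspace M" for p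
    using inj that by (simp add: g_def)
  have topN: "topspace N = e ` topspace M"
    using ge by (auto simp: N_def topspace_pullback_topology)
  have "homeomorphic_maps N M g e"
    unfolding homeomorphic_maps_def
  proof (intro conjI ballI)
    show "continuous_map N M g"
      using continuous_map_pullback[OF continuous_map_id, of "e ` topspace M" g M]
      by (simp add: N_def)
    have "continuous_map M M (g \<circ> e)"
      by (rule continuous_map_eq[of M M id]) (auto simp: ge)
    then show "continuous_map M N e"
      unfolding N_def by (rule continuous_map_pullback') auto
  qed (auto simp: topN ge)
  then show ?thesis
    using homeomorphic_maps_map by blast
qed

lemma separable_metrizable_retype:
  fixes M :: "'b topology"
  assumes "metrizable_space M" "separable_space M"
  shows "\<exists>(N :: (nat \<Rightarrow> nat) topology) g.
           metrizable_space N \<and> separable_space N \<and> homeomorphic_map N M g"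
proof -
  obtain C where C: "countable C" "M closure_of C = topspace M"
    using assms(2) unfolding separable_space_def by blast
  have "C = from_nat_into C ` (if C = {} then {} else UNIV)"
    using C(1) by simp
  then obtain N :: "(nat \<Rightarrow> nat) topology" and g where g: "homeomorphic_map N M g"
    using metrizable_retype[OF assms(1), of "from_nat_into C"] C(2) by metis
  then show ?thesis
    using assms homeomorphic_metrizable_space homeomorphic_separable_space
      homeomorphic_map_imp_homeomorphic_space by metis
qed

lemma precompact_in_homeomorphic_map:
  assumes g: "homeomorphic_map N M g" and P: "P \<subseteq> topspace N" "precompact_in M (g ` P)"
  shows "precompact_in N P"
proof -
  have "M closure_of (g ` P) = g ` (N closure_of P)"
    using homeomorphic_map_closure_of[OF g P(1)] by simp
  then show ?thesis
    using P homeomorphic_map_compactness[OF g closure_of_subset_topspace[of N P]]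
    by (simp add: precompact_in_def)
qed

lemma subproper_map_compose_homeomorphic_map:
  assumes g: "homeomorphic_map N M g" and f: "subproper_map M X f"
  shows "subproper_map N X (f \<circ> g)"
proof -
  obtain Z where Z: "Z \<subseteq> topspace M" "f ` Z = topspace X"
    "\<And>K. precompact_in X K \<Longrightarrow> precompact_in M (Z \<inter> {z \<in> topspace M. f z \<in> K})"
    using f unfolding subproper_map_def by blast
  have im: "g ` topspace N = topspace M"
    using g homeomorphic_imp_surjective_map by blast
  define W where "W = {w \<in> topspace N. g w \<in> Z}"
  have gW: "g ` W = Z"
    using Z(1) im unfolding W_def by auto
  show ?thesis
    unfolding subproper_map_def
  proof (intro conjI exI allI impI)
    show "continuous_map N X (f \<circ> g)"
      using f g homeomorphic_imp_continuous_map continuous_map_compose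
      unfolding subproper_map_def by metis
    show "W \<subseteq> topspace N"
      by (auto simp: W_def)
    show "(f \<circ> g) ` W = topspace X"
      using gW Z(2) by (metis image_comp)
    fix K assume "precompact_in X K"
    then have "precompact_in M (Z \<inter> {z \<in> topspace M. f z \<in> K})"
      by (rule Z(3))
    moreover have "g ` (W \<inter> {z \<in> topspace N. (f \<circ> g) z \<in> K}) = Z \<inter> {z \<in> topspace M. f z \<in> K}"
      using im gW Z(1) unfolding W_def by auto
    ultimately show "precompact_in N (W \<inter> {z \<in> topspace N. (f \<circ> g) z \<in> K})"
      using precompact_in_homeomorphic_map[OF g] by (metis (no_types, lifting) Int_Collect subsetI)
  qed
qed

lemma subproper_map_imp_surjective_map:
  assumes "subproper_map M X f"
  shows "f ` topspace M = topspace X"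
proof (rule antisym)
  show "f ` topspace M \<subseteq> topspace X"
    using assms continuous_map_image_subset_topspace unfolding subproper_map_def by blast
  show "topspace X \<subseteq> f ` topspace M"
    using assms unfolding subproper_map_def by (metis image_mono)
qed

lemma separable_subproper_retype:
  fixes M :: "'b topology" and X :: "'a topology"
  assumes "metrizable_space M" "separable_space M" "subproper_map M X f"
  shows "\<exists>(N :: (nat \<Rightarrow> nat) topology) \<pi>.
           metrizable_space N \<and> separable_space N \<and>
           subproper_map N X \<pi> \<and> \<pi> ` topspace N = topspace X"
proof -
  obtain N :: "(nat \<Rightarrow> nat) topology" and g
    where N: "metrizable_space N" "separable_space N" and g: "homeomorphic_map N M g"
    using separable_metrizable_retype[OF assms(1,2)] by blast
  have "subproper_map N X (f \<circ> g)"
    using g assms(3) by (rule subproper_map_compose_homeomorphic_map)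
  then show ?thesis
    using N subproper_map_imp_surjective_map by blast
qed

lemma separable_quotient_retype:
  fixes M :: "'b topology" and X :: "'a topology"
  assumes "metrizable_space M" "separable_space M" "quotient_map M X f"
  shows "\<exists>(N :: (nat \<Rightarrow> nat) topology) \<pi>.
           metrizable_space N \<and> separable_space N \<and> quotient_map N X \<pi>"
  using separable_metrizable_retype[OF assms(1,2)] quotient_map_compose[OF _ assms(3)]
  unfolding homeomorphic_map_def by metis

lemma metrizable_closure_retype:
  fixes M :: "'b topology" and s :: "'a \<Rightarrow> 'b"
  assumes "metrizable_space M" "s ` D \<subseteq> topspace M"
  shows "\<exists>(N :: (nat \<Rightarrow> 'a) topology) g.
           metrizable_space N \<and> homeomorphic_map N (subtopology M (M closure_of (s ` D))) g"
proof -
  let ?C = "M closure_of (s ` D)"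
  have sub: "s ` D \<subseteq> ?C"
    using assms(2) by (rule closure_of_subset)
  have m: "metrizable_space (subtopology M ?C)"
    using assms(1) by (rule metrizable_space_subtopology)
  have "subtopology M ?C closure_of (s ` D) = topspace (subtopology M ?C)"
    using sub closure_of_subset_topspace[of M "s ` D"]
    by (simp add: closure_of_subtopology Int_absorb1 Int_absorb2 inf.absorb2)
  from metrizable_retype[OF m this] show ?thesis
    using m homeomorphic_metrizable_space homeomorphic_map_imp_homeomorphic_space by metis
qed

lemma k_star_metrizableI:
  fixes M :: "'b topology" and X :: "'a topology"
  assumes X: "Hausdorff_space X" and M: "metrizable_space M" and f: "subproper_map M X f"
  shows "k_star_metrizable X"
proof -
  obtain Z where Z: "Z \<subseteq> topspace M" "f ` Z = topspace X"
    "\<And>K. precompact_in X K \<Longrightarrow> precompact_in M (Z \<inter> {z \<in> topspace M. f z \<in> K})"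
    and cf: "continuous_map M X f"
    using f unfolding subproper_map_def by blast
  have "\<forall>x \<in> topspace X. \<exists>z \<in> Z. f z = x"
    using Z(2) by (metis imageE)
  then obtain s where s: "\<And>x. x \<in> topspace X \<Longrightarrow> s x \<in> Z \<and> f (s x) = x"
    by metis
  define S where "S = s ` topspace X"
  have S: "S \<subseteq> topspace M" "S \<subseteq> Z"
    using s Z(1) by (auto simp: S_def)
  define C where "C = M closure_of S"
  have C: "closedin M C" "S \<subseteq> C" "C \<subseteq> topspace M"
    using S by (auto simp: C_def closure_of_subset closure_of_subset_topspace in_closure_of)
  obtain N :: "(nat \<Rightarrow> 'a) topology" and g
    where N: "metrizable_space N" and g: "homeomorphic_map N (subtopology M C) g"
    using metrizable_closure_retype[OF M, of s "topspace X"] S(1) unfolding C_def S_def by blast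
  have "subproper_map (subtopology M C) X f"
    unfolding subproper_map_def
  proof (intro conjI exI[of _ S] allI impI)
    show "continuous_map (subtopology M C) X f"
      using cf by (rule continuous_map_from_subtopology)
    show "S \<subseteq> topspace (subtopology M C)"
      using S C by auto
    show "f ` S = topspace X"
      using s by (force simp: S_def image_image)
    fix K assume "precompact_in X K"
    then have *: "compactin M (M closure_of (Z \<inter> {z \<in> topspace M. f z \<in> K}))"
      using Z(3) by (simp add: precompact_in_def)
    let ?P = "S \<inter> {z \<in> topspace (subtopology M C). f z \<in> K}"
    have P: "?P \<subseteq> C" "?P \<subseteq> Z \<inter> {z \<in> topspace M. f z \<in> K}"
      using S C by auto
    then have "M closure_of ?P \<subseteq> M closure_of (Z \<inter> {z \<in> topspace M. f z \<in> K})"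
      by (intro closure_of_mono)
    then have 1: "compactin M (M closure_of ?P)"
      by (rule closed_compactin[OF * _ closedin_closure_of])
    have 2: "M closure_of ?P \<subseteq> C"
      using P(1) C(1) by (rule closure_of_minimal)
    have "subtopology M C closure_of ?P = M closure_of ?P"
      using P(1) 2 by (simp add: closure_of_subtopology Int_absorb1)
    then show "precompact_in (subtopology M C) ?P"
      using 1 2 by (auto simp: precompact_in_def compactin_subtopology)
  qed
  then have "subproper_map N X (f \<circ> g)"
    using g by (intro subproper_map_compose_homeomorphic_map)
  moreover from this have "(f \<circ> g) ` topspace N = topspace X"
    by (rule subproper_map_imp_surjective_map)
  ultimately show ?thesis
    unfolding k_star_metrizable_def using X N by blast
qed

lemma cs_star_metrizableI:
  fixes M :: "'b topology" and X :: "'a topology"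
  assumes X: "Hausdorff_space X" and M: "metrizable_space M" and f: "continuous_map M X f"
    and s: "section_of M X f s" "cs_star_continuous X M s"
  shows "cs_star_metrizable X"
proof -
  define S where "S = s ` topspace X"
  have S: "S \<subseteq> topspace M" and fs: "\<And>x. x \<in> topspace X \<Longrightarrow> f (s x) = x"
    using s by (auto simp: S_def section_of_def)
  define C where "C = M closure_of S"
  have C: "closedin M C" "S \<subseteq> C" "C \<subseteq> topspace M"
    using S by (auto simp: C_def closure_of_subset closure_of_subset_topspace in_closure_of)
  obtain N :: "(nat \<Rightarrow> 'a) topology" and g
    where N: "metrizable_space N" and g: "homeomorphic_map N (subtopology M C) g"
    using metrizable_closure_retype[OF M, of s "topspace X"] S unfolding C_def S_def by blast
  obtain h where h: "homeomorphic_maps N (subtopology M C) g h"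
    using g homeomorphic_map_maps by blast
  have topC: "topspace (subtopology M C) = C"
    using C by auto
  have cg: "continuous_map N (subtopology M C) g" and ch: "continuous_map (subtopology M C) N h"
    and gh: "\<And>y. y \<in> C \<Longrightarrow> g (h y) = y" and hg: "\<And>y. y \<in> topspace N \<Longrightarrow> h (g y) = y"
    using h topC by (auto simp: homeomorphic_maps_def)
  have hN: "h y \<in> topspace N" if "y \<in> C" for y
    using ch that topC continuous_map_image_subset_topspace by blast
  have sC: "s x \<in> C" if "x \<in> topspace X" for x
    using that C(2) by (auto simp: S_def)
  have sec: "section_of N X (f \<circ> g) (h \<circ> s)"
    unfolding section_of_def using hN sC gh fs by auto
  have cont: "continuous_map N X (f \<circ> g)"
    using cg continuous_map_from_subtopology[OF f] continuous_map_compose by blast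
  have img: "(f \<circ> g) ` topspace N = topspace X"
  proof (rule antisym)
    show "(f \<circ> g) ` topspace N \<subseteq> topspace X"
      using cont by (rule continuous_map_image_subset_topspace)
    show "topspace X \<subseteq> (f \<circ> g) ` topspace N"
    proof
      fix x assume "x \<in> topspace X"
      then have "(f \<circ> g) (h (s x)) = x" "h (s x) \<in> topspace N"
        using sC gh fs hN by auto
      then show "x \<in> (f \<circ> g) ` topspace N"
        by (metis imageI)
    qed
  qed
  have cs: "cs_star_continuous X N (h \<circ> s)"
    unfolding cs_star_continuous_def
  proof (intro conjI allI impI)
    show "(h \<circ> s) ` topspace X \<subseteq> topspace N"
      using hN sC by auto
    fix y assume y: "range y \<subseteq> topspace X \<and> (\<exists>l. limitin X y l sequentially)"
    then obtain p where p: "accumulation_point M (\<lambda>n. s (y n)) p"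
      using s(2) unfolding cs_star_continuous_def by blast
    have yC: "s (y n) \<in> C" for n
      using y sC by blast
    have pC: "p \<in> C"
    proof (rule ccontr)
      assume "p \<notin> C"
      then have "openin M (topspace M - C)" "p \<in> topspace M - C"
        using p C(1) by (auto simp: accumulation_point_def)
      then have "infinite {n. s (y n) \<in> topspace M - C}"
        using p by (auto simp: accumulation_point_def)
      then show False
        using yC by simp
    qed
    have "accumulation_point N (\<lambda>n. (h \<circ> s) (y n)) (h p)"
      unfolding accumulation_point_def
    proof (intro conjI allI impI)
      show "h p \<in> topspace N"
        using hN pC by blast
      fix U assume U: "openin N U \<and> h p \<in> U"
      have "openin (subtopology M C) {z \<in> topspace (subtopology M C). h z \<in> U}"
        using U ch openin_continuous_map_preimage by blast
      then obtain V where V: "openin M V" "{z \<in> C. h z \<in> U} = V \<inter> C"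
        unfolding openin_subtopology topC by blast
      then have "p \<in> V"
        using pC U by blast
      then have "infinite {n. s (y n) \<in> V}"
        using p V(1) by (auto simp: accumulation_point_def)
      moreover have "{n. s (y n) \<in> V} \<subseteq> {n. (h \<circ> s) (y n) \<in> U}"
        using V(2) yC by auto
      ultimately show "infinite {n. (h \<circ> s) (y n) \<in> U}"
        using finite_subset by blast
    qed
    then show "\<exists>p. accumulation_point N (\<lambda>n. (h \<circ> s) (y n)) p"
      by blast
  qed
  show ?thesis
    unfolding cs_star_metrizable_def using X N cont img sec cs by blast
qed

end

theory Submission
  imports Defs
begin

text \<open>All the conditions are compared with one property: \<open>X\<close> has a countable
  \<open>cs\<^sup>*\<close>-network, that is, a countable family of sets such that whenever
  \<open>x\<^sub>n \<rightarrow> l \<in> U\<close> with \<open>U\<close> open, some member lies in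
  \<open>U\<close> and contains infinitely many \<open>x\<^sub>n\<close>. For regular \<open>X\<close> this
  already makes \<open>X\<close> an \<open>\<aleph>\<^sub>0\<close>-space
  (\<open>countable_cs_star_network_imp_aleph0_space\<close>): if a compact \<open>K \<subseteq> U\<close>
  were not covered by finitely many of the members inside \<open>U\<close>, a sequence of uncovered points would
  have a convergent subsequence, since the countable network forces \<open>K\<close> to be sequentially compact,
  and some member would contain infinitely many of its terms.

  From a section \<open>s\<close> witnessing \<open>cs\<^sup>*\<close>-metrizability, such families are obtained
  by pulling back a base of the metrizable space. A \<open>\<sigma>\<close>-locally finite base (which exists by
  Stone's construction) pulls back to a \<open>cs\<^sup>*\<close>-network that is a countable union of cs-finite
  families: a convergent sequence meets only finitely many members of each. It remains to see why each cs-finite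
  family is countable. Choosing a point in each member gives a set all of whose subsets are sequentially closed,
  hence a closed discrete subset of \<open>sX\<close>; so countable extent of \<open>sX\<close> suffices. A
  countable network of \<open>X\<close> in turn gives countable extent of \<open>sX\<close>, because every
  uncountable subset of \<open>X\<close> contains a nontrivial convergent sequence together with its limit. When
  \<open>kX\<close> is a quotient of a separable metrizable space, the images of a countable base are a
  countable \<open>cs\<^sup>*\<close>-network directly.

  Conversely, an \<open>\<aleph>\<^sub>0\<close>-space is the subproper image of a space of sequences of natural
  numbers: a point is coded by choosing, in each finite subfamily of a closed countable
  \<open>k\<close>-network, a member that contains it, if there is one
  (\<open>aleph0_space_imp_subproper_image\<close>). Since only finitely many choices are possible at each
  coordinate, codes of points of a compact set have limits, and compactness shows that these limits are codes
  again. Subproper maps onto Hausdorff spaces are compact-covering, so those with metrizable domain are quotient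
  maps onto \<open>kX\<close>; and if \<open>kX\<close> is \<open>k\<^sup>*\<close>-metrizable, then
  \<open>kX = sX\<close>.

  The last equivalence needs countability of the cs-finite families of a separable regular sequential space
  under the Continuum Hypothesis. Closures of open sets are closures of subsets of a countable dense set, so
  there are at most \<open>\<aleph>\<^sub>1\<close> of them. If every neighbourhood of a point \<open>y\<close>
  met uncountably many members of a cs-finite family, a transfinite selection would produce a closed set missing
  \<open>y\<close> but meeting the closure of every neighbourhood of \<open>y\<close>, against regularity. Hence
  the families are locally countable. Chains of network members, each small compared with its predecessor, then
  expand every member to an open set such that each point lies in countably many expansions; a countable dense
  set meets all of them, so there are only countably many
  (\<open>locally_countable_cs_star_network_imp_countable\<close>).\<close>

section \<open>Convergent sequences and the two coreflexions\<close>

definition sequential_space :: "'a topology \<Rightarrow> bool" where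
  "sequential_space X \<longleftrightarrow> (\<forall>A. seq_closed_in X A \<longrightarrow> closedin X A)"

lemma infinite_imp_subsequence:
  assumes "infinite {n :: nat. P n}"
  obtains r :: "nat \<Rightarrow> nat" where "strict_mono r" "\<And>n. P (r n)"
  using infinite_enumerate[OF assms] by auto

lemma eventually_sequentially_iff_finite:
  "eventually P sequentially \<longleftrightarrow> finite {n. \<not> P n}"
  by (simp only: cofinite_eq_sequentially[symmetric] eventually_cofinite)

lemma closedin_seq_coreflexion: "closedin (seq_coreflexion X) A \<longleftrightarrow> seq_closed_in X A"
proof (cases "A \<subseteq> topspace X")
  case True
  then have "topspace X - (topspace X - A) = A"
    by blast
  then show ?thesis
    using True by (simp add: closedin_def openin_seq_coreflexion seq_open_in_def)
next
  case False
  then show ?thesis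
    by (simp add: closedin_def seq_closed_in_def)
qed

text \<open>A sequence that leaves a sequentially open set \<open>U\<close> infinitely often has a subsequence
  in the sequentially closed complement of \<open>U\<close>, so its limit is not in \<open>U\<close>. Hence the
  finer topology has no fewer convergent sequences.\<close>

lemma limitin_seq_coreflexion:
  "limitin (seq_coreflexion X) x l sequentially \<longleftrightarrow> limitin X x l sequentially"
proof
  assume "limitin (seq_coreflexion X) x l sequentially"
  then show "limitin X x l sequentially"
    by (simp add: limitin_def openin_seq_coreflexion_finer)
next
  assume lim: "limitin X x l sequentially"
  show "limitin (seq_coreflexion X) x l sequentially"
    unfolding limitin_def
  proof (intro conjI allI impI)
    show "l \<in> topspace (seq_coreflexion X)"
      using lim limitin_topspace by fastforce
    fix U assume U: "openin (seq_coreflexion X) U \<and> l \<in> U"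
    show "eventually (\<lambda>n. x n \<in> U) sequentially"
    proof (rule ccontr)
      assume "\<not> eventually (\<lambda>n. x n \<in> U) sequentially"
      then have inf: "infinite {n. x n \<notin> U}"
        by (simp add: eventually_sequentially_iff_finite)
      have "eventually (\<lambda>n. x n \<in> topspace X) sequentially"
        using limitinD[OF lim, of "topspace X"] limitin_topspace[OF lim] by simp
      then have fin: "finite {n. x n \<notin> topspace X}"
        by (simp add: eventually_sequentially_iff_finite)
      have "{n. x n \<notin> U} \<subseteq> {n. x n \<notin> topspace X} \<union> {n. x n \<in> topspace X - U}"
        by blast
      then have "infinite {n. x n \<in> topspace X - U}"
        using inf fin finite_subset by (metis finite_UnI)
      then obtain r :: "nat \<Rightarrow> nat"
        where r: "strict_mono r" "\<And>n. x (r n) \<in> topspace X - U"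
        using infinite_imp_subsequence[of "\<lambda>n. x n \<in> topspace X - U"] by blast
      have "limitin X (x \<circ> r) l sequentially"
        by (rule limitin_subsequence[OF r(1) lim])
      moreover have "range (x \<circ> r) \<subseteq> topspace X - U"
        using r(2) by auto
      moreover have "seq_closed_in X (topspace X - U)"
        using U by (simp add: openin_seq_coreflexion seq_open_in_def)
      ultimately have "l \<in> topspace X - U"
        unfolding seq_closed_in_def by blast
      then show False
        using U by simp
    qed
  qed
qed

lemma sequential_space_seq_coreflexion: "sequential_space (seq_coreflexion X)"
  unfolding sequential_space_def closedin_seq_coreflexion
  by (simp add: seq_closed_in_def limitin_seq_coreflexion)

lemma metrizable_imp_sequential_space:
  assumes "metrizable_space M"
  shows "sequential_space M"
proof -
  obtain A d where "Metric_space A d" "M = Metric_space.mtopology A d"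
    using assms unfolding metrizable_space_def by blast
  then show ?thesis
    unfolding sequential_space_def seq_closed_in_def
    by (simp add: Metric_space.metric_closedin_iff_sequentially_closed
        Metric_space.topspace_mtopology)
qed

text \<open>Preimages of sequentially closed sets under continuous maps are sequentially closed, hence closed in
  a sequential domain. This is how metrizable spaces mapping onto \<open>X\<close> also map onto
  \<open>sX\<close>.\<close>

lemma continuous_map_into_seq_coreflexion:
  assumes M: "sequential_space M" and f: "continuous_map M X f"
  shows "continuous_map M (seq_coreflexion X) f"
  unfolding continuous_map_closedin
proof (intro conjI allI impI)
  show "f \<in> topspace M \<rightarrow> topspace (seq_coreflexion X)"
    using f by (simp add: continuous_map_def)
  fix C assume "closedin (seq_coreflexion X) C"
  then have C: "seq_closed_in X C"
    by (simp add: closedin_seq_coreflexion)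
  have "seq_closed_in M {x \<in> topspace M. f x \<in> C}"
    unfolding seq_closed_in_def
  proof (intro conjI allI impI)
    fix x l assume *: "range x \<subseteq> {x \<in> topspace M. f x \<in> C} \<and> limitin M x l sequentially"
    then have "limitin X (f \<circ> x) (f l) sequentially"
      using continuous_map_limit[OF f] by blast
    moreover have "range (f \<circ> x) \<subseteq> C"
      using * by auto
    ultimately have "f l \<in> C"
      using C unfolding seq_closed_in_def by blast
    then show "l \<in> {x \<in> topspace M. f x \<in> C}"
      using * limitin_topspace by fastforce
  qed auto
  then show "closedin M {x \<in> topspace M. f x \<in> C}"
    using M by (simp add: sequential_space_def)
qed

lemma compactin_insert_limit:
  assumes lim: "limitin X x l sequentially" and x: "range x \<subseteq> topspace X"
  shows "compactin X (insert l (range x))"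
  unfolding compactin_def
proof (intro conjI allI impI)
  show "insert l (range x) \<subseteq> topspace X"
    using x limitin_topspace[OF lim] by simp
  fix \<U> assume U: "Ball \<U> (openin X) \<and> insert l (range x) \<subseteq> \<Union>\<U>"
  then obtain V where V: "V \<in> \<U>" "l \<in> V"
    by blast
  then have "eventually (\<lambda>n. x n \<in> V) sequentially"
    using U lim by (auto simp: limitin_def)
  then obtain N where N: "\<And>n. n \<ge> N \<Longrightarrow> x n \<in> V"
    unfolding eventually_sequentially by blast
  have "\<exists>W. W \<in> \<U> \<and> x n \<in> W" for n
    using U by blast
  then obtain W where W: "\<And>n. W n \<in> \<U> \<and> x n \<in> W n"
    by metis
  show "\<exists>\<F>. finite \<F> \<and> \<F> \<subseteq> \<U> \<and> insert l (range x) \<subseteq> \<Union>\<F>"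
  proof (intro exI[of _ "insert V (W ` {..<N})"] conjI)
    show "insert l (range x) \<subseteq> \<Union> (insert V (W ` {..<N}))"
    proof
      fix z assume "z \<in> insert l (range x)"
      then consider "z = l" | n where "z = x n"
        by blast
      then show "z \<in> \<Union> (insert V (W ` {..<N}))"
      proof cases
        case 2
        then show ?thesis
          using N[of n] W[of n] by (cases "n < N") auto
      qed (use V in simp)
    qed
  qed (use V W in auto)
qed

text \<open>A convergent sequence with its limit is compact, so a set that is open relative to all compact sets
  contains almost all terms of every sequence converging into it. In general the topology of \<open>sX\<close>
  is thus finer than that of \<open>kX\<close>.\<close>

lemma openin_kification_imp_seq_coreflexion:
  assumes "openin (kification X) U"
  shows "openin (seq_coreflexion X) U"
  unfolding openin_seq_coreflexion seq_open_in_def seq_closed_in_def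
proof (intro conjI allI impI)
  show U: "U \<subseteq> topspace X"
    using openin_subset[OF assms] by simp
  fix x l assume A: "range x \<subseteq> topspace X - U \<and> limitin X x l sequentially"
  let ?K = "insert l (range x)"
  have K: "compactin X ?K"
    using A by (intro compactin_insert_limit) auto
  then have o: "openin (subtopology X ?K) (?K \<inter> U)"
    using assms by (simp add: openin_kification)
  then obtain V where V: "openin X V" "?K \<inter> U = V \<inter> ?K"
    unfolding openin_subtopology by blast
  have "l \<notin> U"
  proof
    assume "l \<in> U"
    then have "l \<in> V"
      using V by blast
    then have "eventually (\<lambda>n. x n \<in> V) sequentially"
      using A V(1) by (auto simp: limitin_def)
    then obtain n where "x n \<in> V"
      using eventually_happens' sequentially_bot by blast
    then have "x n \<in> U"
      using V(2) by blast
    then show False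
      using A by blast
  qed
  then show "l \<in> topspace X - U"
    using A limitin_topspace[of X x l] by blast
qed auto

lemma limitin_kification:
  "limitin (kification X) x l sequentially \<longleftrightarrow> limitin X x l sequentially"
proof
  assume "limitin (kification X) x l sequentially"
  then show "limitin X x l sequentially"
    by (simp add: limitin_def openin_kification_finer)
next
  assume "limitin X x l sequentially"
  then have "limitin (seq_coreflexion X) x l sequentially"
    by (simp add: limitin_seq_coreflexion)
  then show "limitin (kification X) x l sequentially"
    by (simp add: limitin_def openin_kification_imp_seq_coreflexion)
qed

lemma limitin_imp_finite_outside:
  assumes "limitin X x l sequentially" "openin X U" "l \<in> U"
  shows "finite {n. x n \<notin> U}"
  using assms unfolding limitin_def by (simp add: eventually_sequentially_iff_finite)

lemma t1_limitin_finite_range: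
  assumes X: "t1_space X" and F: "finite F" and x: "range x \<subseteq> F" "F \<subseteq> topspace X"
    and lim: "limitin X x l sequentially"
  shows "l \<in> F"
proof -
  have "closedin X F"
    using X F x(2) by (simp add: t1_space_closedin_finite)
  then show ?thesis
    using limitin_closedin[OF lim _ _ sequentially_bot] x(1) by (auto simp: range_subsetD)
qed

section \<open>Sigma-locally finite bases of metrizable spaces\<close>

text \<open>Stone's construction. For fixed radius, each point \<open>x\<close> is assigned to the least centre
  \<open>a\<close> (in some well-order) whose ball contains \<open>x\<close>, and then recorded at level
  \<open>k\<close> if even the ball of radius \<open>1 / (k + 1)\<close> around \<open>x\<close> lies in the
  ball of \<open>a\<close>. At a fixed level, points assigned to different centres are at least
  \<open>1 / (k + 1)\<close> apart, so thickening each class by a third of this leaves the classes uniformly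
  separated. Uniform separation is stronger than local finiteness, and the thickened classes stay inside the
  balls that they refine.\<close>

lemma metrizable_imp_sigma_locally_finite_base:
  fixes M :: "'b topology"
  assumes "metrizable_space M"
  obtains \<B> :: "nat \<Rightarrow> 'b set set" where
    "\<And>m. locally_finite_in M (\<B> m)"
    "\<And>m B. B \<in> \<B> m \<Longrightarrow> openin M B"
    "\<And>U p. openin M U \<Longrightarrow> p \<in> U \<Longrightarrow> \<exists>m. \<exists>B \<in> \<B> m. p \<in> B \<and> B \<subseteq> U"
proof -
  obtain A d where Ad: "Metric_space A d" and M: "M = Metric_space.mtopology A d"
    using assms unfolding metrizable_space_def by blast
  interpret Metric_space A d
    by (rule Ad)
  obtain r :: "'b rel" where r: "well_order_on UNIV r"
    using well_order_on by blast
  have wf: "wf (r - Id)" and tot: "\<And>a b. a \<noteq> b \<Longrightarrow> (a, b) \<in> r - Id \<or> (b, a) \<in> r - Id"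
    using r unfolding well_order_on_def linear_order_on_def total_on_def by auto
  \<comment> \<open>\<open>S n k a\<close> is the class of the centre \<open>a\<close> at level
    \<open>k\<close>, for balls of radius \<open>1 / (n + 1)\<close>; \<open>T n k a\<close> is its
    thickening.\<close>
  define U where "U = (\<lambda>n a. mball a (1 / real (Suc n)))"
  define S where "S = (\<lambda>n k a. {x \<in> A. mball x (1 / real (Suc k)) \<subseteq> U n a \<and>
                                      (\<forall>b \<in> A. (b, a) \<in> r - Id \<longrightarrow> x \<notin> U n b)})"
  define T where "T = (\<lambda>n k a. \<Union>x \<in> S n k a. mball x (1 / real (Suc k) / 3))"
  define \<B> where "\<B> = (\<lambda>m. (case prod_decode m of (n, k) \<Rightarrow> T n k ` A))"
  have B: "\<B> (prod_encode (n, k)) = T n k ` A" for n k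
    by (simp add: \<B>_def)
  have sep1: "1 / real (Suc k) \<le> d x y"
    if "x \<in> S n k a" "y \<in> S n k b" "(a, b) \<in> r - Id" "a \<in> A" for x y n k a b
  proof (rule ccontr)
    assume "\<not> 1 / real (Suc k) \<le> d x y"
    then have "y \<in> mball x (1 / real (Suc k))"
      using that by (simp add: S_def)
    then have "y \<in> U n a"
      using that(1) by (auto simp: S_def)
    then show False
      using that(2-4) by (auto simp: S_def)
  qed
  have sep: "1 / real (Suc k) \<le> d x y"
    if "x \<in> S n k a" "y \<in> S n k b" "a \<noteq> b" "a \<in> A" "b \<in> A" for x y n k a b
    using sep1[of x n k a y b] sep1[of y n k b x a] tot[OF that(3)] that commute[of x y] by auto
  have openT: "openin mtopology (T n k a)" for n k a
    unfolding T_def by (intro openin_Union) auto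
  have lf: "locally_finite_in mtopology (T n k ` A)" for n k
    unfolding locally_finite_in_def
  proof (intro conjI ballI)
    show "\<Union> (T n k ` A) \<subseteq> topspace mtopology"
      using openT openin_subset by blast
    fix p assume p: "p \<in> topspace mtopology"
    define e where "e = 1 / real (Suc k)"
    let ?V = "mball p (e / 6)"
    \<comment> \<open>The gap between two thickened classes is at least a third of \<open>e\<close>, which
      bounds the diameter of \<open>?V\<close>.\<close>
    have eq: "a = b" if ab: "a \<in> A" "b \<in> A" "T n k a \<inter> ?V \<noteq> {}" "T n k b \<inter> ?V \<noteq> {}" for a b
    proof (rule ccontr)
      assume "a \<noteq> b"
      obtain x u where x: "x \<in> S n k a" "u \<in> mball x (e / 3)" "u \<in> ?V"
        using ab(3) unfolding T_def e_def by blast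
      obtain y v where y: "y \<in> S n k b" "v \<in> mball y (e / 3)" "v \<in> ?V"
        using ab(4) unfolding T_def e_def by blast
      have in_A: "x \<in> A" "u \<in> A" "p \<in> A" "v \<in> A" "y \<in> A"
        using x y by (auto simp: S_def)
      have "d x y \<le> d x u + d u p + d p v + d v y"
        using triangle[of x u y] triangle[of u p y] triangle[of p v y] in_A by linarith
      also have "\<dots> < e / 3 + e / 6 + e / 6 + e / 3"
        using x(2,3) y(2,3) commute[of u p] commute[of v y] by (intro add_strict_mono) auto
      finally show False
        using sep[OF x(1) y(1) \<open>a \<noteq> b\<close> ab(1,2)] unfolding e_def[symmetric] by linarith
    qed
    have "finite {B \<in> T n k ` A. B \<inter> ?V \<noteq> {}}"
    proof (cases "\<exists>a \<in> A. T n k a \<inter> ?V \<noteq> {}")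
      case True
      then obtain a where "a \<in> A" "T n k a \<inter> ?V \<noteq> {}"
        by blast
      then have "{B \<in> T n k ` A. B \<inter> ?V \<noteq> {}} \<subseteq> {T n k a}"
        using eq by blast
      then show ?thesis
        using finite_subset by blast
    next
      case False
      then have "{B \<in> T n k ` A. B \<inter> ?V \<noteq> {}} = {}"
        by blast
      then show ?thesis
        by (simp only: finite.emptyI)
    qed
    moreover have "e > 0"
      by (simp add: e_def)
    ultimately show "\<exists>V. openin mtopology V \<and> p \<in> V \<and> finite {B \<in> T n k ` A. B \<inter> V \<noteq> {}}"
      using p by (intro exI[of _ ?V]) auto
  qed
  have base: "\<exists>m. \<exists>B \<in> \<B> m. p \<in> B \<and> B \<subseteq> W" if W: "openin mtopology W" "p \<in> W" for W p
  proof -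
    obtain e where e: "e > 0" "mball p e \<subseteq> W"
      using W unfolding openin_mtopology by blast
    have p: "p \<in> A"
      using W openin_subset by fastforce
    obtain n where n: "1 / real (Suc n) < e / 2"
      using e(1) nat_approx_posE[of "e / 2"] by auto
    have "p \<in> U n p"
      using p by (simp add: U_def)
    then have "p \<in> {a \<in> A. p \<in> U n a}"
      using p by simp
    from wf[unfolded wf_eq_minimal, rule_format, OF this]
    obtain a where a: "a \<in> A" "p \<in> U n a"
      and least: "\<And>b. (b, a) \<in> r - Id \<Longrightarrow> b \<notin> {a \<in> A. p \<in> U n a}"
      by auto
    have "openin mtopology (U n a)"
      by (simp add: U_def)
    then obtain e' where e': "e' > 0" "mball p e' \<subseteq> U n a"
      using a(2) unfolding openin_mtopology by blast
    obtain k where k: "1 / real (Suc k) < e'"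
      using e'(1) nat_approx_posE by blast
    have "mball p (1 / real (Suc k)) \<subseteq> U n a"
      using mball_subset_concentric[of "1 / real (Suc k)" e' p] k e'(2) by force
    then have pS: "p \<in> S n k a"
      using p a least by (auto simp: S_def)
    then have "p \<in> T n k a"
      using p by (auto simp: T_def)
    moreover have "T n k a \<subseteq> W"
    proof -
      have "T n k a \<subseteq> U n a"
      proof
        fix z assume "z \<in> T n k a"
        then obtain x where x: "x \<in> S n k a" "z \<in> mball x (1 / real (Suc k) / 3)"
          by (auto simp: T_def)
        have "1 / real (Suc k) / 3 \<le> 1 / real (Suc k)"
          by (simp add: frac_le)
        then have "z \<in> mball x (1 / real (Suc k))"
          using mball_subset_concentric[of "1 / real (Suc k) / 3" "1 / real (Suc k)" x] x(2) by blast
        then show "z \<in> U n a"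
          using x(1) by (auto simp: S_def)
      qed
      also have "U n a \<subseteq> mball p e"
      proof
        fix z assume z: "z \<in> U n a"
        have "d p z \<le> d a p + d a z"
          using triangle[of p a z] commute[of a p] z a p by (auto simp: U_def)
        also have "\<dots> < e"
          using z a n by (simp add: U_def)
        finally show "z \<in> mball p e"
          using z p by (simp add: U_def)
      qed
      finally show ?thesis
        using e(2) by blast
    qed
    ultimately show ?thesis
      using B[of n k] a(1) by blast
  qed
  show thesis
  proof (rule that)
    show "locally_finite_in M (\<B> m)" for m
      using lf by (simp add: \<B>_def M split: prod.split)
    show "openin M B" if "B \<in> \<B> m" for m B
      using that openT by (auto simp: \<B>_def M split: prod.splits)
    show "\<exists>m. \<exists>B \<in> \<B> m. p \<in> B \<and> B \<subseteq> W" if "openin M W" "p \<in> W" for W p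
      using base that by (simp add: M)
  qed
qed

section \<open>Networks of cs*-metrizable spaces\<close>

text \<open>The trace, seen by convergent sequences, of local finiteness of a family in a metrizable
  preimage.\<close>

definition cs_finite :: "'a topology \<Rightarrow> 'a set set \<Rightarrow> bool" where
  "cs_finite X \<N> \<longleftrightarrow>
     \<N> \<subseteq> Pow (topspace X) \<and>
     (\<forall>x l. range x \<subseteq> topspace X \<and> limitin X x l sequentially
        \<longrightarrow> finite {N \<in> \<N>. \<exists>n. x n \<in> N})"

definition is_cs_star_network :: "'a topology \<Rightarrow> 'a set set \<Rightarrow> bool" where
  "is_cs_star_network X \<N> \<longleftrightarrow>
     \<N> \<subseteq> Pow (topspace X) \<and>
     (\<forall>U x l. openin X U \<and> l \<in> U \<and> range x \<subseteq> topspace X \<and> limitin X x l sequentially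
        \<longrightarrow> (\<exists>N \<in> \<N>. N \<subseteq> U \<and> infinite {n. x n \<in> N}))"

lemma cs_finiteD:
  assumes "cs_finite X \<N>" "range x \<subseteq> topspace X" "limitin X x l sequentially"
  shows "finite {N \<in> \<N>. \<exists>n. x n \<in> N}"
proof -
  have "\<forall>x l. range x \<subseteq> topspace X \<and> limitin X x l sequentially
      \<longrightarrow> finite {N \<in> \<N>. \<exists>n. x n \<in> N}"
    using assms(1) unfolding cs_finite_def by (rule conjunct2)
  from this[rule_format, of x l] show ?thesis
    using assms(2,3) by blast
qed

lemma cs_finite_imp_subset_topspace: "cs_finite X \<N> \<Longrightarrow> N \<in> \<N> \<Longrightarrow> N \<subseteq> topspace X"
proof -
  assume "cs_finite X \<N>"
  then have "\<N> \<subseteq> Pow (topspace X)"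
    unfolding cs_finite_def by (rule conjunct1)
  then show "N \<in> \<N> \<Longrightarrow> N \<subseteq> topspace X"
    by (rule PowD[OF subsetD])
qed

text \<open>Accumulation points of the lifted sequence are mapped to accumulation points of the sequence below,
  and a convergent sequence in a Hausdorff space accumulates only at its limit.\<close>

lemma section_accumulation_point:
  assumes X: "Hausdorff_space X" and f: "continuous_map M X f"
    and s: "\<And>y. y \<in> topspace X \<Longrightarrow> f (s y) = y"
    and x: "range x \<subseteq> topspace X" "limitin X x l sequentially"
    and p: "accumulation_point M (\<lambda>n. s (x n)) p"
  shows "f p = l"
proof (rule ccontr)
  assume ne: "f p \<noteq> l"
  have "p \<in> topspace M" "l \<in> topspace X"
    using p x(2) limitin_topspace by (auto simp: accumulation_point_def)
  moreover from this have "f p \<in> topspace X"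
    using f by (auto simp: continuous_map_def)
  ultimately obtain V W where VW: "openin X V" "openin X W" "f p \<in> V" "l \<in> W" "disjnt V W"
    using X ne unfolding Hausdorff_space_def by metis
  have "openin M {z \<in> topspace M. f z \<in> V}"
    using f VW(1) openin_continuous_map_preimage by blast
  then have "infinite {n. s (x n) \<in> {z \<in> topspace M. f z \<in> V}}"
    using p VW(3) by (auto simp: accumulation_point_def)
  moreover have "{n. s (x n) \<in> {z \<in> topspace M. f z \<in> V}} \<subseteq> {n. x n \<notin> W}"
    using s x(1) VW(5) by (auto simp: disjnt_iff range_subsetD)
  moreover have "finite {n. x n \<notin> W}"
    using limitin_imp_finite_outside[OF x(2) VW(2,4)] .
  ultimately show False
    using finite_subset by blast
qed

text \<open>If a convergent sequence met infinitely many of the sets, one could pass to a subsequence whose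
  terms hit pairwise distinct members of the base; the lift of this subsequence has an accumulation point, all
  of whose neighbourhoods meet infinitely many members, against local finiteness.\<close>

lemma cs_finite_preimages:
  assumes s: "cs_star_continuous X M s" and B: "locally_finite_in M \<B>"
  shows "cs_finite X ((\<lambda>B. {x \<in> topspace X. s x \<in> B}) ` \<B>)"
  unfolding cs_finite_def
proof (intro conjI allI impI)
  fix x l assume x: "range x \<subseteq> topspace X \<and> limitin X x l sequentially"
  have sx: "s (x n) \<in> topspace M" for n
    using s x unfolding cs_star_continuous_def by blast
  have each: "finite {B \<in> \<B>. q \<in> B}" if q: "q \<in> topspace M" for q
  proof -
    obtain V where V: "q \<in> V" "finite {B \<in> \<B>. B \<inter> V \<noteq> {}}"
      using B q unfolding locally_finite_in_def by blast
    have "{B \<in> \<B>. q \<in> B} \<subseteq> {B \<in> \<B>. B \<inter> V \<noteq> {}}"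
      using V(1) by blast
    then show ?thesis
      using V(2) finite_subset by blast
  qed
  define hit where "hit = (\<lambda>n. {B \<in> \<B>. s (x n) \<in> B})"
  have fin: "finite (hit n)" for n
    using each[OF sx] by (simp add: hit_def)
  have "finite (\<Union>n. hit n)"
  proof (rule ccontr)
    assume inf: "infinite (\<Union>n. hit n)"
    have step: "\<exists>m B. n \<le> m \<and> B \<in> hit m \<and> (\<forall>j<n. B \<notin> hit j)" for n
    proof -
      have "finite (\<Union>j<n. hit j)"
        using fin by simp
      then have "\<not> (\<Union>n. hit n) \<subseteq> (\<Union>j<n. hit j)"
        using inf finite_subset by metis
      then obtain B m where B: "B \<in> hit m" "B \<notin> (\<Union>j<n. hit j)"
        by blast
      then have "\<not> m < n"
        by blast
      then show ?thesis
        using B by (intro exI[of _ m] exI[of _ B]) auto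
    qed
    then obtain g h where gh: "\<And>n. n \<le> g n" "\<And>n. h n \<in> hit (g n)"
      "\<And>n j. j < n \<Longrightarrow> h n \<notin> hit j"
      by metis
    \<comment> \<open>\<open>C k\<close> contains the lift of the term with index \<open>r k\<close> but of no
      term with index at most \<open>r (k - 1)\<close>, which makes the \<open>C k\<close> distinct.\<close>
    define r where "r = rec_nat (g 0) (\<lambda>_ n. g (Suc n))"
    define C where "C = (\<lambda>k. case k of 0 \<Rightarrow> h 0 | Suc k \<Rightarrow> h (Suc (r k)))"
    have r_Suc: "r (Suc k) = g (Suc (r k))" for k
      by (simp add: r_def)
    have r: "strict_mono r"
      unfolding strict_mono_Suc_iff r_Suc using gh(1) Suc_le_lessD by blast
    have C_in: "C k \<in> hit (r k)" for k
      using gh(2) by (cases k) (auto simp: C_def r_def)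
    have C_out: "C k \<notin> hit (r j)" if "j < k" for j k
    proof (cases k)
      case (Suc i)
      then have "r j \<le> r i"
        using that r by (simp add: strict_mono_less_eq)
      then show ?thesis
        using gh(3)[of "r j" "Suc (r i)"] Suc by (simp add: C_def)
    qed (use that in simp)
    have C_inj: "inj C"
      by (rule linorder_injI) (metis C_in C_out)
    have "limitin X (x \<circ> r) l sequentially"
      using x by (intro limitin_subsequence[OF r]) blast
    moreover have "range (x \<circ> r) \<subseteq> topspace X"
      using x by auto
    ultimately obtain p where p: "accumulation_point M (\<lambda>k. s ((x \<circ> r) k)) p"
      using s unfolding cs_star_continuous_def by blast
    obtain V where V: "openin M V" "p \<in> V" "finite {B \<in> \<B>. B \<inter> V \<noteq> {}}"
      using B p unfolding locally_finite_in_def accumulation_point_def by blast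
    have "infinite {k. s (x (r k)) \<in> V}"
      using p V(1,2) unfolding accumulation_point_def by auto
    then have "infinite (C ` {k. s (x (r k)) \<in> V})"
      using C_inj finite_imageD inj_on_subset by blast
    moreover have "C ` {k. s (x (r k)) \<in> V} \<subseteq> {B \<in> \<B>. B \<inter> V \<noteq> {}}"
      using C_in unfolding hit_def by blast
    ultimately show False
      using V(3) finite_subset by blast
  qed
  then have "finite ((\<lambda>B. {x \<in> topspace X. s x \<in> B}) ` (\<Union>n. hit n))"
    by simp
  moreover have "{N \<in> (\<lambda>B. {x \<in> topspace X. s x \<in> B}) ` \<B>. \<exists>n. x n \<in> N}
      \<subseteq> (\<lambda>B. {x \<in> topspace X. s x \<in> B}) ` (\<Union>n. hit n)"
    by (auto simp: hit_def)
  ultimately show "finite {N \<in> (\<lambda>B. {x \<in> topspace X. s x \<in> B}) ` \<B>. \<exists>n. x n \<in> N}"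
    by (rule rev_finite_subset)
qed auto

text \<open>A basic neighbourhood, inside the preimage of \<open>U\<close>, of an accumulation point of the
  lifted sequence contains infinitely many lifted terms; its preimage under the section is contained in its
  image under \<open>f\<close>, hence in \<open>U\<close>.\<close>

lemma cs_star_network_preimages:
  assumes X: "Hausdorff_space X" and f: "continuous_map M X f"
    and sec: "section_of M X f s" and s: "cs_star_continuous X M s"
    and B: "\<And>B. B \<in> \<B> \<Longrightarrow> openin M B"
      "\<And>U p. openin M U \<Longrightarrow> p \<in> U \<Longrightarrow> \<exists>B \<in> \<B>. p \<in> B \<and> B \<subseteq> U"
  shows "is_cs_star_network X ((\<lambda>B. {x \<in> topspace X. s x \<in> B}) ` \<B>)"
  unfolding is_cs_star_network_def
proof (intro conjI allI impI)
  fix U x l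
  assume *: "openin X U \<and> l \<in> U \<and> range x \<subseteq> topspace X \<and> limitin X x l sequentially"
  have fs: "\<And>y. y \<in> topspace X \<Longrightarrow> f (s y) = y"
    using sec by (simp add: section_of_def)
  obtain p where p: "accumulation_point M (\<lambda>n. s (x n)) p"
    using s * unfolding cs_star_continuous_def by blast
  have "f p = l"
    using section_accumulation_point[OF X f fs _ _ p] * by blast
  moreover have "openin M {z \<in> topspace M. f z \<in> U}"
    using f * openin_continuous_map_preimage by blast
  moreover have "p \<in> topspace M"
    using p by (simp add: accumulation_point_def)
  ultimately obtain B where B': "B \<in> \<B>" "p \<in> B" "B \<subseteq> {z \<in> topspace M. f z \<in> U}"
    using B(2)[of "{z \<in> topspace M. f z \<in> U}" p] * by auto
  have "infinite {n. s (x n) \<in> B}"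
    using p B(1) B' unfolding accumulation_point_def by blast
  moreover have "{n. s (x n) \<in> B} = {n. x n \<in> {y \<in> topspace X. s y \<in> B}}"
    using * by auto
  ultimately have "infinite {n. x n \<in> {y \<in> topspace X. s y \<in> B}}"
    by simp
  moreover have "{y \<in> topspace X. s y \<in> B} \<subseteq> U"
    using B'(3) fs by force
  ultimately show "\<exists>N \<in> (\<lambda>B. {x \<in> topspace X. s x \<in> B}) ` \<B>. N \<subseteq> U \<and> infinite {n. x n \<in> N}"
    using B'(1) by blast
qed auto

lemma cs_star_metrizable_imp_sigma_cs_finite_network:
  fixes X :: "'a topology"
  assumes "cs_star_metrizable X"
  shows "\<exists>\<N> :: nat \<Rightarrow> 'a set set.
    (\<forall>m. cs_finite X (\<N> m)) \<and> is_cs_star_network X (\<Union>m. \<N> m)"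
proof -
  obtain M :: "(nat \<Rightarrow> 'a) topology" and f s where
    X: "Hausdorff_space X" and M: "metrizable_space M" and f: "continuous_map M X f"
    and s: "section_of M X f s" "cs_star_continuous X M s"
    using assms unfolding cs_star_metrizable_def by blast
  obtain \<B> :: "nat \<Rightarrow> (nat \<Rightarrow> 'a) set set" where
    lf: "\<And>m. locally_finite_in M (\<B> m)"
    and B: "\<And>m B. B \<in> \<B> m \<Longrightarrow> openin M B"
      "\<And>U p. openin M U \<Longrightarrow> p \<in> U \<Longrightarrow> \<exists>m. \<exists>B \<in> \<B> m. p \<in> B \<and> B \<subseteq> U"
    by (rule metrizable_imp_sigma_locally_finite_base[OF M]) blast
  let ?N = "\<lambda>m. (\<lambda>B. {x \<in> topspace X. s x \<in> B}) ` \<B> m"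
  have "is_cs_star_network X ((\<lambda>B. {x \<in> topspace X. s x \<in> B}) ` (\<Union>m. \<B> m))"
  proof (rule cs_star_network_preimages[OF X f s])
    show "openin M B" if "B \<in> (\<Union>m. \<B> m)" for B
      using that B(1) by auto
    show "\<exists>B \<in> (\<Union>m. \<B> m). p \<in> B \<and> B \<subseteq> U" if "openin M U" "p \<in> U" for U p
      using B(2)[OF that] by auto
  qed
  then have "is_cs_star_network X (\<Union>m. ?N m)"
    by (simp add: image_UN)
  moreover have "cs_finite X (?N m)" for m
    using cs_finite_preimages[OF s(2) lf] .
  ultimately show ?thesis
    by (intro exI[of _ ?N]) simp
qed

section \<open>Countable extent of sequential spaces\<close>

text \<open>A convergent sequence in the selector meets only finitely many members of \<open>\<A>\<close>, so it
  has finite range. Applied to subfamilies, this makes every subset of a selector sequentially closed.\<close>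

lemma seq_closed_in_selector:
  assumes X: "t1_space X" and A: "cs_finite X \<A>" "\<B> \<subseteq> \<A>"
    and g: "\<And>N. N \<in> \<B> \<Longrightarrow> g N \<in> N"
  shows "seq_closed_in X (g ` \<B>)"
  unfolding seq_closed_in_def
proof (intro conjI allI impI)
  show sub: "g ` \<B> \<subseteq> topspace X"
  proof
    fix z assume "z \<in> g ` \<B>"
    then obtain N where "N \<in> \<B>" "z = g N"
      by (rule imageE)
    then show "z \<in> topspace X"
      using g[of N] A(2) cs_finite_imp_subset_topspace[OF A(1), of N] by (simp add: subset_iff)
  qed
  fix x l assume x: "range x \<subseteq> g ` \<B> \<and> limitin X x l sequentially"
  let ?F = "{N \<in> \<A>. \<exists>n. x n \<in> N}"
  have "range x \<subseteq> topspace X"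
    using x sub by blast
  then have "finite ?F"
    using cs_finiteD[OF A(1)] x by blast
  then have fin: "finite (g ` (?F \<inter> \<B>))"
    by simp
  have "range x \<subseteq> g ` (?F \<inter> \<B>)"
  proof
    fix z assume "z \<in> range x"
    then obtain n where n: "z = x n"
      by blast
    moreover obtain N where N: "N \<in> \<B>" "x n = g N"
      using x by blast
    moreover have "N \<in> ?F"
      using N g[OF N(1)] A(2) by (metis (mono_tags, lifting) mem_Collect_eq subsetD)
    ultimately show "z \<in> g ` (?F \<inter> \<B>)"
      by blast
  qed
  moreover have "g ` (?F \<inter> \<B>) \<subseteq> topspace X"
    using sub by blast
  ultimately have "l \<in> g ` (?F \<inter> \<B>)"
    using t1_limitin_finite_range[OF X fin] x by blast
  then show "l \<in> g ` \<B>"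
    by blast
qed

lemma cs_finite_point_finite:
  assumes "cs_finite X \<A>" "x \<in> topspace X"
  shows "finite {N \<in> \<A>. x \<in> N}"
proof -
  have "limitin X (\<lambda>_ :: nat. x) x sequentially"
    using assms(2) by (simp add: limitin_def)
  from cs_finiteD[OF assms(1) _ this] show ?thesis
    using assms(2) by simp
qed

text \<open>A selector of the nonempty members is closed and discrete, hence countable, and each of its points
  lies in finitely many members only.\<close>

lemma countable_extent_imp_countable_cs_finite:
  assumes X: "sequential_space X" "t1_space X" "countable_extent X" and A: "cs_finite X \<A>"
  shows "countable \<A>"
proof -
  define g where "g = (\<lambda>N :: 'a set. SOME x. x \<in> N)"
  have g: "g N \<in> N" if "N \<in> \<A> - {{}}" for N
  proof -
    have "\<exists>x. x \<in> N"
      using that by auto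
    then show ?thesis
      unfolding g_def by (rule someI_ex)
  qed
  let ?D = "g ` (\<A> - {{}})"
  have closed: "closedin X E" if "E \<subseteq> ?D" for E
  proof -
    obtain \<B> where B: "\<B> \<subseteq> \<A> - {{}}" "E = g ` \<B>"
      using \<open>E \<subseteq> ?D\<close> by (meson subset_image_iff)
    have "seq_closed_in X (g ` \<B>)"
      by (rule seq_closed_in_selector[OF X(2) A]) (use B g in auto)
    then show ?thesis
      using X(1) B(2) by (simp add: sequential_space_def)
  qed
  have "subtopology X ?D = discrete_topology ?D"
  proof -
    have top: "topspace (subtopology X ?D) = ?D"
      using closedin_subset[OF closed[OF subset_refl]] by auto
    have "openin (subtopology X ?D) E" if "E \<subseteq> ?D" for E
    proof -
      have "closedin (subtopology X ?D) (?D - E)"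
        using closed[of "?D - E"] by (metis Diff_subset closedin_subset_topspace)
      then have "openin (subtopology X ?D) (?D - (?D - E))"
        using openin_diff[of "subtopology X ?D" ?D "?D - E"] top openin_topspace by metis
      then show ?thesis
        using that by (simp add: double_diff)
    qed
    moreover have "E \<subseteq> ?D" if "openin (subtopology X ?D) E" for E
      using openin_subset[OF that] top by simp
    ultimately show ?thesis
      unfolding topology_eq openin_discrete_topology by blast
  qed
  moreover have "closedin X ?D"
    by (rule closed) (rule subset_refl)
  ultimately have D: "countable ?D"
    using X(3) unfolding countable_extent_def by blast
  have top: "?D \<subseteq> topspace X"
    by (rule closedin_subset) (rule closed[OF subset_refl])
  have "\<A> \<subseteq> insert {} (\<Union>x \<in> ?D. {N \<in> \<A>. x \<in> N})"
  proof
    fix N assume "N \<in> \<A>"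
    then show "N \<in> insert {} (\<Union>x \<in> ?D. {N \<in> \<A>. x \<in> N})"
      using g[of N] by (cases "N = {}") auto
  qed
  moreover have "countable (\<Union>x \<in> ?D. {N \<in> \<A>. x \<in> N})"
  proof (rule countable_UN[OF D])
    fix x assume "x \<in> ?D"
    then have "x \<in> topspace X"
      using top by (rule subsetD[rotated])
    then show "countable {N \<in> \<A>. x \<in> N}"
      by (intro countable_finite cs_finite_point_finite[OF A])
  qed
  ultimately show ?thesis
    by (meson countable_insert countable_subset)
qed

section \<open>From countable cs*-networks to countable k-networks\<close>

lemma is_networkD:
  assumes "is_network X \<N>" "openin X U" "x \<in> U"
  shows "\<exists>N \<in> \<N>. x \<in> N \<and> N \<subseteq> U"
  using assms unfolding is_network_def by blast

lemma is_cs_star_networkD: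
  assumes "is_cs_star_network X \<N>" "openin X U" "l \<in> U" "range x \<subseteq> topspace X"
    "limitin X x l sequentially"
  shows "\<exists>N \<in> \<N>. N \<subseteq> U \<and> infinite {n. x n \<in> N}"
proof -
  have "\<forall>U x l. openin X U \<and> l \<in> U \<and> range x \<subseteq> topspace X \<and> limitin X x l sequentially
        \<longrightarrow> (\<exists>N \<in> \<N>. N \<subseteq> U \<and> infinite {n. x n \<in> N})"
    using assms(1) unfolding is_cs_star_network_def by (rule conjunct2)
  from this[rule_format, of U l x] show ?thesis
    using assms(2-5) by simp
qed

lemma cs_star_network_imp_network:
  assumes "is_cs_star_network X \<N>"
  shows "is_network X \<N>"
  unfolding is_network_def
proof (intro conjI allI impI)
  show "\<N> \<subseteq> Pow (topspace X)"
    using assms unfolding is_cs_star_network_def by (rule conjunct1)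
  fix U x assume U: "openin X U \<and> x \<in> U"
  then have x: "x \<in> topspace X"
    using openin_subset by blast
  then have "limitin X (\<lambda>_ :: nat. x) x sequentially"
    by (simp add: limitin_def)
  from is_cs_star_networkD[OF assms _ _ _ this] obtain N where
    "N \<in> \<N>" "N \<subseteq> U" "infinite {n :: nat. x \<in> N}"
    using U x by auto
  moreover from this(3) have "x \<in> N"
    by (rule contrapos_np) simp
  ultimately show "\<exists>N \<in> \<N>. x \<in> N \<and> N \<subseteq> U"
    by blast
qed

lemma compactin_imp_accumulation_point:
  assumes K: "compactin X K" and x: "range x \<subseteq> K"
  obtains l where "l \<in> K" "accumulation_point X x l"
proof -
  have "\<exists>l \<in> K. accumulation_point X x l"
  proof (rule ccontr)
    assume no: "\<not> (\<exists>l \<in> K. accumulation_point X x l)"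
    have "\<exists>U. openin X U \<and> l \<in> U \<and> finite {n. x n \<in> U}" if "l \<in> K" for l
      using no that compactin_subset_topspace[OF K] unfolding accumulation_point_def by auto
    then obtain U where U: "\<And>l. l \<in> K \<Longrightarrow> openin X (U l) \<and> l \<in> U l \<and> finite {n. x n \<in> U l}"
      by metis
    have "Ball (U ` K) (openin X)" "K \<subseteq> \<Union>(U ` K)"
      using U by auto
    then obtain \<F> where F: "finite \<F>" "\<F> \<subseteq> U ` K" "K \<subseteq> \<Union>\<F>"
      using K unfolding compactin_def by meson
    have "UNIV = (\<Union>V \<in> \<F>. {n. x n \<in> V})"
      using F(3) x by auto
    moreover have "finite (\<Union>V \<in> \<F>. {n. x n \<in> V})"
      using F(1,2) U by auto
    ultimately have "finite (UNIV :: nat set)"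
      by simp
    then show False
      by simp
  qed
  then show thesis
    using that by blast
qed

lemma accumulation_point_closedin:
  assumes "accumulation_point X x p" "closedin X C" "\<And>n. n \<ge> n0 \<Longrightarrow> x n \<in> C"
  shows "p \<in> C"
proof (rule ccontr)
  assume "p \<notin> C"
  then have "openin X (topspace X - C)" "p \<in> topspace X - C"
    using assms(1,2) by (auto simp: accumulation_point_def)
  then have "infinite {n. x n \<in> topspace X - C}"
    using assms(1) unfolding accumulation_point_def by blast
  moreover have "{n. x n \<in> topspace X - C} \<subseteq> {..<n0}"
    using assms(3) by (auto simp: not_le[symmetric])
  ultimately show False
    using finite_subset by blast
qed

text \<open>Given an accumulation point \<open>l\<close>, separate it by open sets \<open>V i\<close> from each
  network member whose closure misses \<open>l\<close>, and choose a subsequence that is eventually inside every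
  \<open>V i\<close>. Another accumulation point \<open>q\<close> of it would lie in some member whose closure
  misses \<open>l\<close>, while all but finitely many terms are in the corresponding \<open>V i\<close>, whose
  closure misses \<open>q\<close>.\<close>

lemma compactin_imp_convergent_subsequence:
  assumes X: "Hausdorff_space X" "regular_space X" "has_countable_network X"
    and K: "compactin X K" and x: "range x \<subseteq> K"
  obtains l and r :: "nat \<Rightarrow> nat" where
    "l \<in> K" "strict_mono r" "limitin X (x \<circ> r) l sequentially"
proof -
  obtain \<N> where N: "countable \<N>" "is_network X \<N>"
    using X(3) unfolding has_countable_network_def by blast
  obtain l where l: "l \<in> K" "accumulation_point X x l"
    by (rule compactin_imp_accumulation_point[OF K x])
  have lX: "l \<in> topspace X"
    using l(2) by (simp add: accumulation_point_def)
  define N where "N = from_nat_into \<N>"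
  have "\<exists>V. openin X V \<and> l \<in> V \<and> (l \<notin> X closure_of (N i) \<longrightarrow> N i \<inter> topspace X \<inter> X closure_of V = {})"
    for i
  proof (cases "l \<in> X closure_of (N i)")
    case True
    then show ?thesis
      using lX by auto
  next
    case False
    then obtain V where V: "openin X V" "l \<in> V" "disjnt (X closure_of (N i)) (X closure_of V)"
      using X(2) lX unfolding regular_space by (metis DiffI closedin_closure_of)
    have "N i \<inter> topspace X \<subseteq> X closure_of (N i)"
      by (metis closure_of_subset_Int inf_commute)
    then show ?thesis
      using V by (intro exI[of _ V]) (auto simp: disjnt_iff)
  qed
  then obtain V where V: "\<And>i. openin X (V i)" "\<And>i. l \<in> V i"
    "\<And>i. l \<notin> X closure_of (N i) \<Longrightarrow> N i \<inter> topspace X \<inter> X closure_of (V i) = {}"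
    by metis
  define W where "W = (\<lambda>n. \<Inter>i \<in> {..n}. V i)"
  have W: "openin X (W n)" "l \<in> W n" for n
    unfolding W_def using V(1,2) by (auto intro!: openin_Inter)
  have "\<exists>k>m. x k \<in> W n" for m n
  proof -
    have "infinite {k. x k \<in> W n}"
      using l(2) W unfolding accumulation_point_def by blast
    then show ?thesis
      unfolding infinite_nat_iff_unbounded by auto
  qed
  then obtain g where g: "\<And>m n. m < g m n" "\<And>m n. x (g m n) \<in> W n"
    by metis
  define r where "r = rec_nat (g 0 0) (\<lambda>n m. g m (Suc n))"
  have r: "strict_mono r"
    unfolding strict_mono_Suc_iff using g(1) by (simp add: r_def)
  have xr: "x (r n) \<in> W n" for n
    using g(2) by (cases n) (auto simp: r_def)
  have "limitin X (x \<circ> r) l sequentially"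
    unfolding limitin_def
  proof (intro conjI allI impI)
    fix U assume U: "openin X U \<and> l \<in> U"
    show "eventually (\<lambda>n. (x \<circ> r) n \<in> U) sequentially"
    proof (rule ccontr)
      assume "\<not> ?thesis"
      then have inf: "infinite {n. x (r n) \<notin> U}"
        by (simp add: eventually_sequentially_iff_finite)
      obtain t :: "nat \<Rightarrow> nat" where t: "strict_mono t" "\<And>n. x (r (t n)) \<notin> U"
        using infinite_imp_subsequence[OF inf] by blast
      have "range (\<lambda>n. x (r (t n))) \<subseteq> K"
        using x by auto
      from compactin_imp_accumulation_point[OF K this] obtain q where
        q: "q \<in> K" "accumulation_point X (\<lambda>n. x (r (t n))) q"
        by blast
      have qX: "q \<in> topspace X"
        using q(2) by (simp add: accumulation_point_def)
      have "x (r (t n)) \<in> topspace X - U" for n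
        using t(2) x compactin_subset_topspace[OF K] by blast
      then have "q \<in> topspace X - U"
        using U by (intro accumulation_point_closedin[OF q(2)]) auto
      then have "q \<noteq> l"
        using U by blast
      then obtain A B where AB: "openin X A" "openin X B" "q \<in> A" "l \<in> B" "disjnt A B"
        using X(1) qX lX unfolding Hausdorff_space_def by metis
      obtain P where P: "P \<in> \<N>" "q \<in> P" "P \<subseteq> A"
        using is_networkD[OF N(2) AB(1,3)] by blast
      obtain i where i: "N i = P"
        using from_nat_into_surj[OF N(1) P(1)] unfolding N_def by blast
      have "l \<notin> X closure_of (N i)"
        using AB P(3) i unfolding in_closure_of disjnt_iff by blast
      then have "q \<notin> X closure_of (V i)"
        using V(3) i P(2) qX by blast
      moreover have "q \<in> X closure_of (V i)"
      proof (rule accumulation_point_closedin[OF q(2) closedin_closure_of, of i])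
        fix n assume "i \<le> n"
        then have "i \<le> t n"
          using seq_suble[OF t(1), of n] by linarith
        then have "x (r (t n)) \<in> V i"
          using xr[of "t n"] by (auto simp: W_def)
        then show "x (r (t n)) \<in> X closure_of (V i)"
          using closure_of_subset[OF openin_subset[OF V(1)[of i]]] by blast
      qed
      ultimately show False
        by blast
    qed
  qed (rule lX)
  then show thesis
    using that l(1) r by blast
qed

text \<open>Suppose that the members inside \<open>U\<close> have no finite subfamily covering the compact set
  \<open>K \<subseteq> U\<close>. Pick the \<open>n\<close>-th point of \<open>K\<close> outside the first
  \<open>n\<close> of them. A convergent subsequence meets some member infinitely often, although that member
  contains only finitely many of the chosen points.\<close>

lemma countable_cs_star_network_imp_aleph0_space:
  assumes X: "Hausdorff_space X" "regular_space X"
    and N: "countable \<N>" "is_cs_star_network X \<N>"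
  shows "aleph0_space X"
proof -
  have net: "is_network X \<N>"
    by (rule cs_star_network_imp_network[OF N(2)])
  then have cn: "has_countable_network X"
    using N(1) unfolding has_countable_network_def by blast
  have "is_k_network X \<N>"
    unfolding is_k_network_def
  proof (intro conjI allI impI)
    show "\<N> \<subseteq> Pow (topspace X)"
      using net unfolding is_network_def by (rule conjunct1)
    fix U K assume UK: "openin X U \<and> compactin X K \<and> K \<subseteq> U"
    define \<A> where "\<A> = {N \<in> \<N>. N \<subseteq> U}"
    define N where "N = from_nat_into \<A>"
    have cA: "countable \<A>"
      using N(1) by (simp add: \<A>_def)
    show "\<exists>\<F>. finite \<F> \<and> \<F> \<subseteq> \<N> \<and> K \<subseteq> \<Union>\<F> \<and> \<Union>\<F> \<subseteq> U"
    proof (cases "K = {}")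
      case True
      then show ?thesis
        by (intro exI[of _ "{}"]) auto
    next
      case False
      then have "\<A> \<noteq> {}"
        using is_networkD[OF net] UK unfolding \<A>_def by blast
      then have NA: "N n \<in> \<A>" for n
        unfolding N_def by (rule from_nat_into)
      have "\<exists>n. K \<subseteq> \<Union>(N ` {..n})"
      proof (rule ccontr)
        assume "\<not> (\<exists>n. K \<subseteq> \<Union>(N ` {..n}))"
        then have "\<forall>n. \<exists>y. y \<in> K \<and> (\<forall>i\<le>n. y \<notin> N i)"
          by blast
        then obtain x where x: "\<And>n. x n \<in> K" "\<And>n i. i \<le> n \<Longrightarrow> x n \<notin> N i"
          by metis
        have "range x \<subseteq> K"
          using x(1) by blast
        then obtain l and r :: "nat \<Rightarrow> nat" where
          l: "l \<in> K" and r: "strict_mono r" "limitin X (x \<circ> r) l sequentially"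
          using compactin_imp_convergent_subsequence[OF X cn, of K x] UK by blast
        have "range (x \<circ> r) \<subseteq> topspace X"
          using x(1) UK compactin_subset_topspace by fastforce
        then obtain P where P: "P \<in> \<N>" "P \<subseteq> U" "infinite {n. (x \<circ> r) n \<in> P}"
          using is_cs_star_networkD[OF N(2) _ _ _ r(2), of U] l UK by blast
        then obtain i where i: "N i = P"
          using from_nat_into_surj[OF cA, of P] unfolding N_def \<A>_def by blast
        have "{n. (x \<circ> r) n \<in> P} \<subseteq> {..<i}"
        proof
          fix n assume "n \<in> {n. (x \<circ> r) n \<in> P}"
          then have "\<not> i \<le> r n"
            using x(2)[of i "r n"] i by auto
          then show "n \<in> {..<i}"
            using seq_suble[OF r(1), of n] by simp
        qed
        then show False
          using P(3) finite_subset by blast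
      qed
      then obtain n where n: "K \<subseteq> \<Union>(N ` {..n})"
        by blast
      have "N ` {..n} \<subseteq> \<N>" "\<Union>(N ` {..n}) \<subseteq> U"
        using NA by (auto simp: \<A>_def)
      then show ?thesis
        using n by (intro exI[of _ "N ` {..n}"]) auto
    qed
  qed
  then show ?thesis
    using X N(1) unfolding aleph0_space_def by blast
qed

section \<open>Convergent sequences in spaces with a countable network\<close>

text \<open>Describe a point by the network members that contain it. A point of \<open>D\<close> that is
  determined within \<open>D\<close> by finitely many of these memberships is determined by a finite piece of
  data, so there are only countably many such points. Any other point is approximated by points of
  \<open>D\<close> sharing more and more of its memberships, and these converge to it.\<close>

lemma uncountable_imp_nontrivial_convergent_sequence:
  assumes X: "has_countable_network X" and D: "D \<subseteq> topspace X" "uncountable D"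
  obtains x :: "nat \<Rightarrow> 'a" and l where
    "l \<in> D" "range x \<subseteq> D - {l}" "limitin X x l sequentially"
proof -
  obtain \<N> where N: "countable \<N>" "is_network X \<N>"
    using X unfolding has_countable_network_def by blast
  define N where "N = from_nat_into \<N>"
  have "\<exists>l \<in> D. \<forall>n. \<exists>y \<in> D - {l}. \<forall>i<n. l \<in> N i \<longleftrightarrow> y \<in> N i"
  proof (rule ccontr)
    assume no: "\<not> ?thesis"
    have "\<exists>n. \<forall>y \<in> D. (\<forall>i<n. l \<in> N i \<longleftrightarrow> y \<in> N i) \<longrightarrow> y = l" if "l \<in> D" for l
    proof -
      have "\<not> (\<forall>n. \<exists>y \<in> D - {l}. \<forall>i<n. l \<in> N i \<longleftrightarrow> y \<in> N i)"
        using no that by (rule_tac notI) (erule notE, rule bexI)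
      then obtain n where "\<not> (\<exists>y \<in> D - {l}. \<forall>i<n. l \<in> N i \<longleftrightarrow> y \<in> N i)"
        by (rule not_all[THEN iffD1, THEN exE])
      then show ?thesis
        by (intro exI[of _ n]) auto
    qed
    then have "\<exists>n. \<forall>l \<in> D. \<forall>y \<in> D. (\<forall>i<n l. l \<in> N i \<longleftrightarrow> y \<in> N i) \<longrightarrow> y = l"
      by (intro bchoice) simp
    then obtain n where n: "\<And>l y. l \<in> D \<Longrightarrow> y \<in> D \<Longrightarrow>
        (\<forall>i<n l. l \<in> N i \<longleftrightarrow> y \<in> N i) \<Longrightarrow> y = l"
      by auto
    \<comment> \<open>The finite data determining \<open>l\<close>: the bound and the memberships below
      it.\<close>
    define c where "c = (\<lambda>l. (n l, {i. i < n l \<and> l \<in> N i}))"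
    have "inj_on c D"
    proof (rule inj_onI)
      fix l y assume *: "l \<in> D" "y \<in> D" "c l = c y"
      then have eq: "n l = n y" "{i. i < n l \<and> l \<in> N i} = {i. i < n y \<and> y \<in> N i}"
        unfolding c_def prod.inject by (blast, blast)
      have "l \<in> N i \<longleftrightarrow> y \<in> N i" if "i < n l" for i
      proof -
        have "i \<in> {i. i < n l \<and> l \<in> N i} \<longleftrightarrow> i \<in> {i. i < n y \<and> y \<in> N i}"
          by (simp only: eq(2))
        then show ?thesis
          using that eq(1) by simp
      qed
      then show "l = y"
        using n[OF *(1,2)] by simp
    qed
    moreover have "c ` D \<subseteq> UNIV \<times> Collect finite"
      by (auto simp: c_def)
    then have "countable (c ` D)"
      by (rule countable_subset) (intro countable_SIGMA countable_Collect_finite, simp)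
    ultimately have "countable D"
      using countable_image_inj_on by blast
    then show False
      using D(2) by blast
  qed
  then obtain l where l: "l \<in> D" "\<And>n. \<exists>y \<in> D - {l}. \<forall>i<n. l \<in> N i \<longleftrightarrow> y \<in> N i"
    by blast
  then obtain x where x: "\<And>n. x n \<in> D - {l}" "\<And>n i. i < n \<Longrightarrow> l \<in> N i \<longleftrightarrow> x n \<in> N i"
    by metis
  have "limitin X x l sequentially"
    unfolding limitin_def eventually_sequentially
  proof (intro conjI allI impI)
    show "l \<in> topspace X"
      using l(1) D(1) by blast
    fix U assume "openin X U \<and> l \<in> U"
    then obtain P where P: "P \<in> \<N>" "l \<in> P" "P \<subseteq> U"
      using is_networkD[OF N(2), of U l] by blast
    obtain i where "N i = P"
      using from_nat_into_surj[OF N(1) P(1)] unfolding N_def by blast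
    then show "\<exists>k. \<forall>n\<ge>k. x n \<in> U"
      using x(2)[of i] P by (intro exI[of _ "Suc i"]) auto
  qed
  moreover have "range x \<subseteq> D - {l}"
    using x(1) by blast
  ultimately show thesis
    using that l(1) by blast
qed

text \<open>A nontrivial sequence of \<open>D\<close> converging in \<open>X\<close> to a point of
  \<open>D\<close> converges in \<open>sX\<close> as well, so its limit is not isolated in
  \<open>D\<close>.\<close>

lemma countable_extent_seq_coreflexion:
  assumes "has_countable_network X"
  shows "countable_extent (seq_coreflexion X)"
  unfolding countable_extent_def
proof (intro allI impI)
  fix D assume D: "closedin (seq_coreflexion X) D \<and>
      subtopology (seq_coreflexion X) D = discrete_topology D"
  then have sub: "D \<subseteq> topspace X"
    using closedin_subset by fastforce
  show "countable D"
  proof (rule ccontr)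
    assume "uncountable D"
    from uncountable_imp_nontrivial_convergent_sequence[OF assms sub this]
    obtain x :: "nat \<Rightarrow> 'a" and l where l: "l \<in> D" "range x \<subseteq> D - {l}"
      "limitin X x l sequentially"
      by blast
    have "openin (subtopology (seq_coreflexion X) D) {l}"
      using D l(1) by simp
    then obtain U where U: "openin (seq_coreflexion X) U" "{l} = U \<inter> D"
      unfolding openin_subtopology by blast
    have "finite {n. x n \<notin> U}"
      using limitin_imp_finite_outside[of "seq_coreflexion X" x l U] l(3) U
      by (auto simp: limitin_seq_coreflexion)
    moreover have "x n \<notin> U" for n
      using l(2) U(2) by blast
    ultimately show False
      by simp
  qed
qed

section \<open>Subproper maps and the coreflexions\<close>

lemma precompact_in_kification:
  assumes X: "Hausdorff_space X" and "precompact_in (kification X) K"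
  shows "precompact_in X K"
proof -
  let ?L = "kification X closure_of K"
  have K: "K \<subseteq> topspace X" "compactin X ?L"
    using assms(2) by (auto simp: precompact_in_def)
  have "K \<subseteq> ?L"
    using K(1) by (intro closure_of_subset) simp
  moreover have "closedin X ?L"
    using X K(2) by (rule compactin_imp_closedin)
  ultimately have "X closure_of K \<subseteq> ?L"
    by (rule closure_of_minimal)
  then have "compactin X (X closure_of K)"
    by (rule closed_compactin[OF K(2) _ closedin_closure_of])
  then show ?thesis
    using K(1) by (simp add: precompact_in_def)
qed

lemma subproper_map_into_kification:
  assumes X: "Hausdorff_space X" and M: "metrizable_space M" and f: "subproper_map M X f"
  shows "subproper_map M (kification X) f"
proof -
  obtain Z where Z: "Z \<subseteq> topspace M" "f ` Z = topspace X"
    "\<And>K. precompact_in X K \<Longrightarrow> precompact_in M (Z \<inter> {z \<in> topspace M. f z \<in> K})"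
    using f unfolding subproper_map_def by blast
  have "k_space M"
    using M by (rule metrizable_imp_k_space)
  then have "continuous_map M (kification X) f"
    using f by (simp add: continuous_map_into_kification subproper_map_def)
  then show ?thesis
    unfolding subproper_map_def
    using Z precompact_in_kification[OF X] by (intro conjI exI[of _ Z]) auto
qed

text \<open>The closure of \<open>Z \<inter> f\<^sup>-\<^sup>1(K)\<close> stays inside the closed set
  \<open>f\<^sup>-\<^sup>1(K)\<close>, and it maps onto \<open>K\<close> because \<open>Z\<close> maps onto the
  whole space.\<close>

lemma subproper_map_imp_compact_covering:
  assumes X: "Hausdorff_space X" and f: "subproper_map M X f" and K: "compactin X K"
  obtains L where "compactin M L" "f ` L = K"
proof -
  obtain Z where Z: "Z \<subseteq> topspace M" "f ` Z = topspace X"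
    "\<And>K. precompact_in X K \<Longrightarrow> precompact_in M (Z \<inter> {z \<in> topspace M. f z \<in> K})"
    and cf: "continuous_map M X f"
    using f unfolding subproper_map_def by blast
  have closed: "closedin X K"
    using X K by (rule compactin_imp_closedin)
  have KX: "K \<subseteq> topspace X"
    using K by (rule compactin_subset_topspace)
  have "precompact_in X K"
    using K KX closed by (simp add: precompact_in_def closure_of_closedin)
  from Z(3)[OF this] have pre: "precompact_in M (Z \<inter> {z \<in> topspace M. f z \<in> K})" .
  let ?P = "Z \<inter> {z \<in> topspace M. f z \<in> K}"
  let ?L = "M closure_of ?P"
  have "closedin M {z \<in> topspace M. f z \<in> K}"
    using cf closed closedin_continuous_map_preimage by blast
  then have "?L \<subseteq> {z \<in> topspace M. f z \<in> K}"
    by (intro closure_of_minimal) auto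
  moreover have PL: "?P \<subseteq> ?L"
    by (intro closure_of_subset) auto
  have "K \<subseteq> f ` ?L"
  proof
    fix y assume "y \<in> K"
    then obtain z where z: "z \<in> Z" "f z = y"
      using Z(2) KX by (metis imageE subsetD)
    then have "z \<in> ?P"
      using \<open>y \<in> K\<close> subsetD[OF Z(1)] by auto
    then show "y \<in> f ` ?L"
      using PL z(2) by blast
  qed
  ultimately have "f ` ?L = K"
    by auto
  moreover have "compactin M ?L"
    using pre by (simp add: precompact_in_def)
  ultimately show thesis
    by (intro that)
qed

text \<open>If \<open>L\<close> is compact with image \<open>K\<close>, then \<open>K \<inter> A\<close> is
  the image of the compact set \<open>L \<inter> f\<^sup>-\<^sup>1(A)\<close>.\<close>

lemma closedin_kification_of_preimage:
  assumes X: "Hausdorff_space X" and f: "subproper_map M X f"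
    and A: "A \<subseteq> topspace X" "closedin M {z \<in> topspace M. f z \<in> A}"
  shows "closedin (kification X) A"
  unfolding closedin_kification
proof (intro conjI allI impI A(1))
  fix K assume K: "compactin X K"
  obtain L where L: "compactin M L" "f ` L = K"
    using subproper_map_imp_compact_covering[OF X f K] by blast
  have LM: "L \<subseteq> topspace M"
    using L(1) by (rule compactin_subset_topspace)
  have "compactin M ({z \<in> topspace M. f z \<in> A} \<inter> L)"
    using A(2) L(1) by (rule closed_Int_compactin)
  moreover have "continuous_map M X f"
    using f by (simp add: subproper_map_def)
  ultimately have "compactin X (f ` ({z \<in> topspace M. f z \<in> A} \<inter> L))"
    by (rule image_compactin)
  moreover have "f ` ({z \<in> topspace M. f z \<in> A} \<inter> L) = K \<inter> A"
    using L(2) LM by auto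
  ultimately have "closedin X (K \<inter> A)"
    using X compactin_imp_closedin by metis
  then show "closedin (subtopology X K) (K \<inter> A)"
    by (rule closedin_subset_topspace) simp
qed

lemma subproper_map_imp_quotient_map_kification:
  assumes X: "Hausdorff_space X" and M: "metrizable_space M" and f: "subproper_map M X f"
  shows "quotient_map M (kification X) f"
  unfolding quotient_map_closedin
proof (intro conjI allI impI)
  show "f ` topspace M = topspace (kification X)"
    using subproper_map_imp_surjective_map[OF f] by simp
  fix A assume A: "A \<subseteq> topspace (kification X)"
  have "continuous_map M (kification X) f"
    using subproper_map_into_kification[OF X M f] by (simp add: subproper_map_def)
  then have "closedin (kification X) A \<Longrightarrow> closedin M {z \<in> topspace M. f z \<in> A}"
    using closedin_continuous_map_preimage by blast
  moreover have "closedin M {z \<in> topspace M. f z \<in> A} \<Longrightarrow> closedin (kification X) A"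
    using closedin_kification_of_preimage[OF X f] A by simp
  ultimately show "closedin M {z \<in> topspace M. f z \<in> A} = closedin (kification X) A"
    by blast
qed

text \<open>The witnessing map is continuous into \<open>sX\<close>, its domain being sequential. So sets closed
  in \<open>sX\<close> have closed preimages, which makes them closed in \<open>kX\<close>.\<close>

lemma k_star_metrizable_imp_kification_eq_seq_coreflexion:
  assumes X: "Hausdorff_space X" and k: "k_star_metrizable (kification X)"
  shows "kification X = seq_coreflexion X"
proof -
  obtain M :: "(nat \<Rightarrow> 'a) topology" and f where
    M: "metrizable_space M" and f: "subproper_map M (kification X) f"
    using k unfolding k_star_metrizable_def by blast
  have "continuous_map M (kification X) f"
    using f by (simp add: subproper_map_def)
  then have "continuous_map M X f"
    by (simp add: continuous_map_into_kification metrizable_imp_k_space[OF M])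
  then have cont: "continuous_map M (seq_coreflexion X) f"
    by (rule continuous_map_into_seq_coreflexion[OF metrizable_imp_sequential_space[OF M]])
  have "closedin (kification X) A" if A: "closedin (seq_coreflexion X) A" for A
  proof -
    have "closedin M {z \<in> topspace M. f z \<in> A}"
      using cont A closedin_continuous_map_preimage by blast
    then have "closedin (kification (kification X)) A"
      using closedin_kification_of_preimage[OF Hausdorff_kification[OF X] f, of A]
        closedin_subset[OF A] by simp
    then show ?thesis
      by simp
  qed
  then have "openin (seq_coreflexion X) U \<Longrightarrow> openin (kification X) U" for U
    unfolding openin_closedin_eq by simp
  then show ?thesis
    unfolding topology_eq using openin_kification_imp_seq_coreflexion by blast
qed

text \<open>Any section with values in \<open>Z\<close> is \<open>cs\<^sup>*\<close>-continuous: it maps a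
  convergent sequence, whose terms together with the limit form a compact set, into a precompact set.\<close>

lemma k_star_metrizable_imp_cs_star_metrizable:
  assumes "k_star_metrizable X"
  shows "cs_star_metrizable X"
proof -
  obtain M :: "(nat \<Rightarrow> 'a) topology" and f where
    X: "Hausdorff_space X" and M: "metrizable_space M" and f: "subproper_map M X f"
    using assms unfolding k_star_metrizable_def by blast
  obtain Z where Z: "Z \<subseteq> topspace M" "f ` Z = topspace X"
    "\<And>K. precompact_in X K \<Longrightarrow> precompact_in M (Z \<inter> {z \<in> topspace M. f z \<in> K})"
    and cf: "continuous_map M X f"
    using f unfolding subproper_map_def by blast
  have "\<forall>x \<in> topspace X. \<exists>z. z \<in> Z \<and> f z = x"
    using Z(2) by (metis imageE)
  then obtain s where s: "\<And>x. x \<in> topspace X \<Longrightarrow> s x \<in> Z \<and> f (s x) = x"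
    by metis
  have sM: "s ` topspace X \<subseteq> topspace M"
    using s Z(1) by auto
  have "section_of M X f s"
    unfolding section_of_def using sM s by auto
  moreover have "cs_star_continuous X M s"
    unfolding cs_star_continuous_def
  proof (intro conjI allI impI sM)
    fix y assume "range y \<subseteq> topspace X \<and> (\<exists>l. limitin X y l sequentially)"
    then obtain l where y: "range y \<subseteq> topspace X" "limitin X y l sequentially"
      by blast
    let ?K = "insert l (range y)"
    have K: "compactin X ?K"
      using compactin_insert_limit[OF y(2,1)] .
    have "X closure_of ?K = ?K"
      using compactin_imp_closedin[OF X K] by (rule closure_of_closedin)
    then have "precompact_in X ?K"
      using K compactin_subset_topspace[OF K] by (simp add: precompact_in_def)
    from Z(3)[OF this] have L: "compactin M (M closure_of (Z \<inter> {z \<in> topspace M. f z \<in> ?K}))"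
      by (simp add: precompact_in_def)
    have "range (\<lambda>n. s (y n)) \<subseteq> Z \<inter> {z \<in> topspace M. f z \<in> ?K}"
      using s y(1) Z(1) by auto
    also have "\<dots> \<subseteq> M closure_of (Z \<inter> {z \<in> topspace M. f z \<in> ?K})"
      by (rule closure_of_subset) auto
    finally show "\<exists>p. accumulation_point M (\<lambda>n. s (y n)) p"
      using compactin_imp_accumulation_point[OF L] by blast
  qed
  ultimately show ?thesis
    by (rule cs_star_metrizableI[OF X M cf])
qed

lemma cs_star_metrizable_seq_coreflexion:
  assumes "cs_star_metrizable X"
  shows "cs_star_metrizable (seq_coreflexion X)"
proof -
  obtain M :: "(nat \<Rightarrow> 'a) topology" and f s where
    X: "Hausdorff_space X" and M: "metrizable_space M" and f: "continuous_map M X f"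
    and s: "section_of M X f s" "cs_star_continuous X M s"
    using assms unfolding cs_star_metrizable_def by blast
  have "continuous_map M (seq_coreflexion X) f"
    using continuous_map_into_seq_coreflexion[OF metrizable_imp_sequential_space[OF M] f] .
  moreover have "section_of M (seq_coreflexion X) f s"
    using s(1) by (simp add: section_of_def)
  moreover have "cs_star_continuous (seq_coreflexion X) M s"
    using s(2) by (simp add: cs_star_continuous_def limitin_seq_coreflexion)
  ultimately show ?thesis
    by (rule cs_star_metrizableI[OF Hausdorff_seq_coreflexion[OF X] M])
qed

lemma metrizable_separable_imp_second_countable:
  assumes M: "metrizable_space M" "separable_space M"
  shows "second_countable M"
proof -
  obtain A d where Ad: "Metric_space A d" and Meq: "M = Metric_space.mtopology A d"
    using M(1) unfolding metrizable_space_def by blast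
  interpret Metric_space A d
    by (rule Ad)
  obtain C where C: "countable C" "C \<subseteq> A" "mtopology closure_of C = A"
    using M(2) unfolding separable_space_def Meq by auto
  define \<B> where "\<B> = (\<lambda>(c, n). mball c (1 / real (Suc n))) ` (C \<times> (UNIV :: nat set))"
  have "second_countable mtopology"
    unfolding second_countable_def
  proof (intro exI[of _ \<B>] conjI ballI allI impI)
    show "countable \<B>"
      unfolding \<B>_def by (intro countable_image countable_SIGMA C(1)) simp
    show "openin mtopology V" if "V \<in> \<B>" for V
      using that by (auto simp: \<B>_def)
    fix U x assume U: "openin mtopology U \<and> x \<in> U"
    then obtain e where e: "e > 0" "mball x e \<subseteq> U"
      unfolding openin_mtopology by blast
    have x: "x \<in> A"
      using U openin_subset[of mtopology U] by auto
    obtain n where n: "1 / real (Suc n) < e / 2"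
      using e(1) nat_approx_posE[of "e / 2"] by auto
    have "x \<in> mtopology closure_of C"
      using x C(3) by simp
    moreover have "openin mtopology (mball x (1 / real (Suc n)))" "x \<in> mball x (1 / real (Suc n))"
      using x by simp_all
    ultimately obtain c where c: "c \<in> C" "c \<in> mball x (1 / real (Suc n))"
      unfolding in_closure_of by blast
    have "mball c (1 / real (Suc n)) \<subseteq> mball x e"
    proof
      fix z assume z: "z \<in> mball c (1 / real (Suc n))"
      then have "d x z \<le> d x c + d c z"
        using triangle[of x c z] x by auto
      then show "z \<in> mball x e"
        using z c(2) n by auto
    qed
    then show "\<exists>V \<in> \<B>. x \<in> V \<and> V \<subseteq> U"
      using c e(2) commute[of x c]
      by (intro bexI[of _ "mball c (1 / real (Suc n))"]) (auto simp: \<B>_def)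
  qed
  then show ?thesis
    by (simp add: Meq)
qed

lemma second_countable_image_has_countable_network:
  assumes M: "second_countable M" and f: "continuous_map M X f" "f ` topspace M = topspace X"
  shows "has_countable_network X"
proof -
  obtain \<B> where B: "countable \<B>" "\<And>V. V \<in> \<B> \<Longrightarrow> openin M V"
    "\<And>U x. openin M U \<Longrightarrow> x \<in> U \<Longrightarrow> \<exists>V \<in> \<B>. x \<in> V \<and> V \<subseteq> U"
    using M unfolding second_countable_def by auto
  have "is_network X ((`) f ` \<B>)"
    unfolding is_network_def
  proof (intro conjI allI impI)
    show "(`) f ` \<B> \<subseteq> Pow (topspace X)"
      using f(2) openin_subset[OF B(2)] by fastforce
    fix U y assume U: "openin X U \<and> y \<in> U"
    then have "y \<in> f ` topspace M"
      using openin_subset f(2) by blast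
    then obtain x where x: "x \<in> topspace M" "f x = y"
      by auto
    have "openin M {z \<in> topspace M. f z \<in> U}"
      using f(1) U openin_continuous_map_preimage by blast
    from B(3)[OF this, of x] obtain V where "V \<in> \<B>" "x \<in> V" "V \<subseteq> {z \<in> topspace M. f z \<in> U}"
      using x U by auto
    then show "\<exists>N \<in> (`) f ` \<B>. y \<in> N \<and> N \<subseteq> U"
      using x(2) by (intro bexI[of _ "f ` V"]) auto
  qed
  then show ?thesis
    unfolding has_countable_network_def using B(1) by blast
qed

section \<open>Aleph-zero spaces as subproper images\<close>

lemma is_k_networkD:
  assumes "is_k_network X \<N>" "openin X U" "compactin X K" "K \<subseteq> U"
  shows "\<exists>\<F>. finite \<F> \<and> \<F> \<subseteq> \<N> \<and> K \<subseteq> \<Union>\<F> \<and> \<Union>\<F> \<subseteq> U"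
proof -
  have "\<forall>U K. openin X U \<and> compactin X K \<and> K \<subseteq> U
      \<longrightarrow> (\<exists>\<F>. finite \<F> \<and> \<F> \<subseteq> \<N> \<and> K \<subseteq> \<Union>\<F> \<and> \<Union>\<F> \<subseteq> U)"
    using assms(1) unfolding is_k_network_def by (rule conjunct2)
  from this[rule_format, of U K] show ?thesis
    using assms(2-4) by simp
qed

lemma closure_subset_of_disjnt_open:
  assumes "openin X W" "disjnt V W" "V \<subseteq> topspace X"
  shows "X closure_of V \<subseteq> topspace X - W"
  using assms by (intro closure_of_minimal) (auto simp: disjnt_iff)

text \<open>In a regular space a compact set is covered inside an open set \<open>V\<close> whose closure is
  still contained in \<open>U\<close>; the closures of the members used for \<open>V\<close> work for
  \<open>U\<close>.\<close>

lemma is_k_network_closures: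
  assumes X: "regular_space X" and N: "is_k_network X \<N>"
  shows "is_k_network X ((closure_of) X ` \<N>)"
  unfolding is_k_network_def
proof (intro conjI allI impI)
  show "(closure_of) X ` \<N> \<subseteq> Pow (topspace X)"
    by (simp add: closure_of_subset_topspace image_subset_iff)
  fix U K assume UK: "openin X U \<and> compactin X K \<and> K \<subseteq> U"
  then have "closedin X (topspace X - U)" "disjnt K (topspace X - U)"
    by (auto simp: disjnt_iff)
  then obtain V W where VW: "openin X V" "openin X W" "K \<subseteq> V" "topspace X - U \<subseteq> W" "disjnt V W"
    using regular_space_compact_closed_separation[OF X, of K "topspace X - U"] UK by blast
  obtain \<F> where F: "finite \<F>" "\<F> \<subseteq> \<N>" "K \<subseteq> \<Union>\<F>" "\<Union>\<F> \<subseteq> V"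
    using is_k_networkD[OF N VW(1) _ VW(3)] UK by metis
  have V: "X closure_of V \<subseteq> U"
    using closure_subset_of_disjnt_open[OF VW(2,5) openin_subset[OF VW(1)]] VW(4) by blast
  have FX: "F \<subseteq> topspace X" if "F \<in> \<F>" for F
    using that F(4) openin_subset[OF VW(1)] by blast
  show "\<exists>\<G>. finite \<G> \<and> \<G> \<subseteq> (closure_of) X ` \<N> \<and> K \<subseteq> \<Union>\<G> \<and> \<Union>\<G> \<subseteq> U"
  proof (intro exI[of _ "(closure_of) X ` \<F>"] conjI)
    show "K \<subseteq> \<Union> ((closure_of) X ` \<F>)"
    proof
      fix x assume "x \<in> K"
      then obtain F where "F \<in> \<F>" "x \<in> F"
        using F(3) by auto
      then show "x \<in> \<Union> ((closure_of) X ` \<F>)"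
        using closure_of_subset[OF FX] by auto
    qed
    show "\<Union> ((closure_of) X ` \<F>) \<subseteq> U"
    proof
      fix x assume "x \<in> \<Union> ((closure_of) X ` \<F>)"
      then obtain F where "F \<in> \<F>" "x \<in> X closure_of F"
        by auto
      moreover from this have "F \<subseteq> V"
        using F(4) by auto
      ultimately show "x \<in> U"
        using V closure_of_mono[of F V X] by blast
    qed
  qed (use F in auto)
qed

text \<open>The members \<open>N (\<sigma> i)\<close> form a network at \<open>x\<close>. The sequences
  \<open>\<sigma>\<close> of this kind, with the product topology, are the points of the metrizable space that
  is mapped onto \<open>X\<close>.\<close>

definition nbhd_code :: "'a topology \<Rightarrow> (nat \<Rightarrow> 'a set) \<Rightarrow> (nat \<Rightarrow> nat) \<Rightarrow> 'a \<Rightarrow> bool" where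
  "nbhd_code X N \<sigma> x \<longleftrightarrow>
     x \<in> topspace X \<and> (\<forall>i. x \<in> N (\<sigma> i)) \<and>
     (\<forall>U. openin X U \<and> x \<in> U \<longrightarrow> (\<exists>i. N (\<sigma> i) \<subseteq> U))"

lemma nbhd_code_unique:
  assumes X: "Hausdorff_space X" and "nbhd_code X N \<sigma> x" "nbhd_code X N \<sigma> y"
  shows "x = y"
proof (rule ccontr)
  assume "x \<noteq> y"
  then obtain U V where UV: "openin X U" "openin X V" "x \<in> U" "y \<in> V" "disjnt U V"
    using X assms(2,3) unfolding Hausdorff_space_def nbhd_code_def by metis
  obtain i where "N (\<sigma> i) \<subseteq> U"
    using assms(2) UV(1,3) unfolding nbhd_code_def by blast
  moreover have "y \<in> N (\<sigma> i)"
    using assms(3) unfolding nbhd_code_def by blast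
  ultimately show False
    using UV(4,5) unfolding disjnt_iff by blast
qed

text \<open>Natural numbers \<open>i\<close> code the finite sets \<open>set_decode i\<close>, so that the
  coordinates run over all finite subfamilies of the network. The default value \<open>0\<close> will be the
  index of the whole space, which contains \<open>x\<close> in any case.\<close>

definition cover_choice :: "(nat \<Rightarrow> 'a set) \<Rightarrow> 'a \<Rightarrow> nat \<Rightarrow> nat" where
  "cover_choice N x i =
     (if \<exists>j \<in> set_decode i. x \<in> N j then SOME j. j \<in> set_decode i \<and> x \<in> N j else 0)"

lemma cover_choice_in:
  assumes "\<exists>j \<in> set_decode i. x \<in> N j"
  shows "cover_choice N x i \<in> set_decode i" "x \<in> N (cover_choice N x i)"
proof -
  have "\<exists>j. j \<in> set_decode i \<and> x \<in> N j"
    using assms by blast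
  from someI_ex[OF this] show "cover_choice N x i \<in> set_decode i" "x \<in> N (cover_choice N x i)"
    using assms by (simp_all add: cover_choice_def)
qed

lemma cover_choice_bound: "cover_choice N x i \<in> insert 0 (set_decode i)"
  using cover_choice_in(1)[of i x N] by (auto simp: cover_choice_def)

lemma open_coordinate: "open {\<tau> :: nat \<Rightarrow> nat. \<tau> i \<in> A}"
proof -
  have "open ((\<lambda>\<tau> :: nat \<Rightarrow> nat. \<tau> i) -` A)"
    by (intro open_vimage open_discrete continuous_on_product_coordinates)
  then show ?thesis
    by (simp add: vimage_def)
qed

lemma closed_coordinatewise: "closed {\<tau> :: nat \<Rightarrow> nat. \<forall>i. \<tau> i \<in> S i}"
proof -
  have "{\<tau> :: nat \<Rightarrow> nat. \<forall>i. \<tau> i \<in> S i} = - (\<Union>i. {\<tau>. \<tau> i \<in> - S i})"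
    by auto
  moreover have "open (\<Union>i. {\<tau> :: nat \<Rightarrow> nat. \<tau> i \<in> - S i})"
    by (intro open_UN ballI open_coordinate)
  ultimately show ?thesis
    by (simp only: closed_Compl)
qed

lemma metrizable_space_sequences: "metrizable_space (euclidean :: (nat \<Rightarrow> nat) topology)"
proof -
  have "(euclidean :: nat topology) = discrete_topology UNIV"
    by (simp add: topology_eq open_discrete)
  then have "metrizable_space (product_topology (\<lambda>_ :: nat. euclidean :: nat topology) UNIV)"
    unfolding metrizable_space_product_topology by simp
  then show ?thesis
    by (simp add: euclidean_product_topology)
qed

lemma compact_bounded_codes: "compact {\<tau> :: nat \<Rightarrow> nat. \<forall>i. \<tau> i \<in> insert 0 (set_decode i)}"
proof -
  let ?S = "\<lambda>i. insert 0 (set_decode i)"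
  have "compactin (product_topology (\<lambda>i :: nat. euclidean :: nat topology) UNIV) (PiE UNIV ?S)"
    unfolding compactin_PiE by (simp add: finite_imp_compact)
  moreover have "PiE UNIV ?S = {\<tau>. \<forall>i. \<tau> i \<in> ?S i}"
    by (auto simp: PiE_UNIV_domain)
  ultimately show ?thesis
    by (simp add: euclidean_product_topology)
qed

text \<open>Finitely many coordinates of \<open>\<sigma>\<close> are shared with the code of some point of
  \<open>L\<close>, so by compactness some \<open>q \<in> L\<close> lies in all the closed sets
  \<open>N (\<sigma> i)\<close>. For the network property at \<open>q \<in> U\<close>, cover
  \<open>L\<close> by finitely many members of two kinds, those missing \<open>q\<close> and those contained in
  \<open>U\<close>; at the coordinate of this finite family, \<open>\<sigma>\<close> picks a member containing
  \<open>q\<close>, hence one contained in \<open>U\<close>.\<close>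

lemma limit_of_codes:
  assumes X: "Hausdorff_space X" "regular_space X"
    and N: "N 0 = topspace X" "\<And>i. closedin X (N i)" "is_k_network X (range N)"
    and L: "compactin X L" and \<sigma>: "\<sigma> \<in> closure (cover_choice N ` L)"
  shows "\<exists>x \<in> L. nbhd_code X N \<sigma> x"
proof -
  have LX: "L \<subseteq> topspace X"
    using L by (rule compactin_subset_topspace)
  have in_N: "x \<in> N (cover_choice N x i)" if "x \<in> L" for x i
    using cover_choice_in(2)[of i x N] that LX N(1) by (auto simp: cover_choice_def)
  have "\<exists>x \<in> L. \<forall>i\<le>n. cover_choice N x i = \<sigma> i" for n
  proof -
    have "open (\<Inter>i \<in> {..n}. {\<tau> :: nat \<Rightarrow> nat. \<tau> i \<in> {\<sigma> i}})"
      by (intro open_INT ballI open_coordinate) simp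
    moreover have "\<sigma> \<in> (\<Inter>i \<in> {..n}. {\<tau> :: nat \<Rightarrow> nat. \<tau> i \<in> {\<sigma> i}})"
      by simp
    ultimately have "(\<Inter>i \<in> {..n}. {\<tau> :: nat \<Rightarrow> nat. \<tau> i \<in> {\<sigma> i}}) \<inter> cover_choice N ` L \<noteq> {}"
      using \<sigma> open_Int_closure_eq_empty by blast
    then show ?thesis
      by auto
  qed
  then obtain x where x: "\<And>n. x n \<in> L" "\<And>n i. i \<le> n \<Longrightarrow> cover_choice N (x n) i = \<sigma> i"
    by metis
  have "range x \<subseteq> L"
    using x(1) by auto
  then obtain q where q: "q \<in> L" "accumulation_point X x q"
    by (rule compactin_imp_accumulation_point[OF L])
  have qX: "q \<in> topspace X"
    using q(1) LX by auto
  have "nbhd_code X N \<sigma> q"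
    unfolding nbhd_code_def
  proof (intro conjI allI impI qX)
    fix i show "q \<in> N (\<sigma> i)"
    proof (rule accumulation_point_closedin[OF q(2) N(2), of i])
      fix n assume "i \<le> n"
      then show "x n \<in> N (\<sigma> i)"
        using in_N[OF x(1), of n i] x(2) by simp
    qed
  next
    fix U assume U: "openin X U \<and> q \<in> U"
    then have "closedin X (topspace X - U)" "q \<in> topspace X - (topspace X - U)"
      using qX by auto
    then obtain V where V: "openin X V" "q \<in> V" "disjnt (topspace X - U) (X closure_of V)"
      using X(2) unfolding regular_space by metis
    have cV: "X closure_of V \<subseteq> U"
      using V(3) closure_of_subset_topspace[of X V] by (auto simp: disjnt_iff)
    have VcV: "V \<subseteq> X closure_of V"
      using openin_subset[OF V(1)] by (rule closure_of_subset)
    have "compactin X ((topspace X - V) \<inter> L)"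
      using V(1) L by (intro closed_Int_compactin) auto
    moreover have "openin X (topspace X - {q})"
      using X(1) qX by (simp add: Hausdorff_imp_t1_space closedin_t1_singleton openin_diff)
    moreover have "(topspace X - V) \<inter> L \<subseteq> topspace X - {q}"
      using V(2) by auto
    ultimately obtain \<F>1 where F1: "finite \<F>1" "\<F>1 \<subseteq> range N" "(topspace X - V) \<inter> L \<subseteq> \<Union>\<F>1"
      "\<Union>\<F>1 \<subseteq> topspace X - {q}"
      using is_k_networkD[OF N(3)] by metis
    have "compactin X (X closure_of V \<inter> L)"
      using L by (intro closed_Int_compactin) auto
    moreover have "X closure_of V \<inter> L \<subseteq> U"
      using cV by auto
    ultimately obtain \<F>2 where F2: "finite \<F>2" "\<F>2 \<subseteq> range N" "X closure_of V \<inter> L \<subseteq> \<Union>\<F>2" "\<Union>\<F>2 \<subseteq> U"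
      using is_k_networkD[OF N(3)] U by metis
    have "finite (\<F>1 \<union> \<F>2)" "\<F>1 \<union> \<F>2 \<subseteq> N ` UNIV"
      using F1 F2 by auto
    then obtain J where J: "finite J" "\<F>1 \<union> \<F>2 = N ` J"
      using finite_subset_image by metis
    define i where "i = set_encode J"
    have dec: "set_decode i = J"
      using J(1) by (simp add: i_def)
    have "x i \<in> \<Union>\<F>1 \<or> x i \<in> \<Union>\<F>2"
      using F1(3) F2(3) x(1)[of i] LX VcV by (cases "x i \<in> V") auto
    then have "x i \<in> \<Union>(\<F>1 \<union> \<F>2)"
      by auto
    then have "\<exists>j \<in> set_decode i. x i \<in> N j"
      unfolding J(2) dec by auto
    from cover_choice_in(1)[OF this] have "\<sigma> i \<in> J"
      using x(2)[of i i] dec by simp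
    then have "N (\<sigma> i) \<in> \<F>1 \<union> \<F>2"
      using J(2) by auto
    moreover have "N (\<sigma> i) \<notin> \<F>1"
    proof
      assume "N (\<sigma> i) \<in> \<F>1"
      then have "q \<notin> N (\<sigma> i)"
        using F1(4) by auto
      moreover have "q \<in> N (\<sigma> i)"
      proof (rule accumulation_point_closedin[OF q(2) N(2), of i])
        fix n assume "i \<le> n"
        then show "x n \<in> N (\<sigma> i)"
          using in_N[OF x(1), of n i] x(2) by simp
      qed
      ultimately show False
        by simp
    qed
    ultimately have "N (\<sigma> i) \<subseteq> U"
      using F2(4) by auto
    then show "\<exists>i. N (\<sigma> i) \<subseteq> U"
      by blast
  qed
  then show ?thesis
    using q(1) by blast
qed

lemma second_countable_euclidean:
  "second_countable (euclidean :: 'a :: second_countable_topology topology)"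
proof -
  obtain \<B> :: "'a set set" where B: "countable \<B>" "topological_basis \<B>"
    using ex_countable_basis by blast
  show ?thesis
    unfolding second_countable_def
  proof (intro exI[of _ \<B>] conjI ballI allI impI B(1))
    show "openin euclidean V" if "V \<in> \<B>" for V
      using topological_basis_open[OF B(2) that] by simp
    fix U and x :: 'a assume "openin euclidean U \<and> x \<in> U"
    then have U: "open U" "x \<in> U"
      by auto
    obtain V where "V \<in> \<B>" "x \<in> V" "V \<subseteq> U"
      by (rule topological_basisE[OF B(2) U])
    then show "\<exists>V \<in> \<B>. x \<in> V \<and> V \<subseteq> U"
      by (intro bexI[of _ V] conjI)
  qed
qed

text \<open>The codes of the points of \<open>X\<close> are the set \<open>Z\<close> required by subproperness.
  All codes lie in the compact set of sequences bounded by the finite sets of choices, and limits of codes of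
  points of a compact set do not leave the domain.\<close>

lemma aleph0_space_imp_subproper_image:
  fixes X :: "'a topology"
  assumes "aleph0_space X"
  obtains M :: "(nat \<Rightarrow> nat) topology" and \<pi> where
    "metrizable_space M" "separable_space M" "subproper_map M X \<pi>"
proof -
  have X: "Hausdorff_space X" "regular_space X"
    using assms by (auto simp: aleph0_space_def)
  obtain \<N> where \<N>: "countable \<N>" "is_k_network X \<N>"
    using assms unfolding aleph0_space_def by blast
  let ?C = "insert (topspace X) ((closure_of) X ` \<N>)"
  \<comment> \<open>Index \<open>0\<close> is reserved for the whole space, the default of
    \<open>cover_choice\<close>.\<close>
  define N where "N = case_nat (topspace X) (from_nat_into ?C)"
  have "range (from_nat_into ?C) = ?C"
    using \<N>(1) by (intro range_from_nat_into) auto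
  moreover have "range N = insert (topspace X) (range (from_nat_into ?C))"
    by (subst UNIV_nat_eq) (simp add: N_def image_image)
  ultimately have ran: "range N = ?C"
    by simp
  have N0: "N 0 = topspace X"
    by (simp add: N_def)
  have Ncl: "closedin X (N i)" for i
    using ran by (metis (no_types, lifting) closedin_closure_of closedin_topspace imageE insertE rangeI)
  have "is_k_network X ((closure_of) X ` \<N>)"
    using X(2) \<N>(2) by (rule is_k_network_closures)
  then have Nk: "is_k_network X (range N)"
    unfolding ran is_k_network_def by (smt (verit) PowI insert_subset subset_insertI2 subset_refl)
  define S where "S = {\<sigma>. \<exists>x. nbhd_code X N \<sigma> x}"
  define \<pi> where "\<pi> = (\<lambda>\<sigma>. SOME x. nbhd_code X N \<sigma> x)"
  define M where "M = top_of_set S"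
  have pi_eq: "\<pi> \<sigma> = x" if "nbhd_code X N \<sigma> x" for \<sigma> x
  proof -
    have "nbhd_code X N \<sigma> (\<pi> \<sigma>)"
      unfolding \<pi>_def using that by (rule someI)
    then show ?thesis
      using nbhd_code_unique[OF X(1)] that by metis
  qed
  have pi: "nbhd_code X N \<sigma> (\<pi> \<sigma>)" if "\<sigma> \<in> S" for \<sigma>
    using that pi_eq unfolding S_def by auto
  have lim: "\<exists>x \<in> L. nbhd_code X N \<sigma> x"
    if "compactin X L" "\<sigma> \<in> closure (cover_choice N ` L)" for L \<sigma>
    by (rule limit_of_codes[OF X N0 Ncl Nk that])
  have code: "nbhd_code X N (cover_choice N x) x" if "x \<in> topspace X" for x
    using lim[of "{x}" "cover_choice N x"] that
      subsetD[OF closure_subset, of "cover_choice N x" "{cover_choice N x}"] by simp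
  have topM: "topspace M = S"
    by (simp add: M_def)
  have cont: "continuous_map M X \<pi>"
    unfolding continuous_map
  proof (intro conjI allI impI)
    show "\<pi> ` topspace M \<subseteq> topspace X"
      using pi unfolding topM nbhd_code_def by auto
    fix U assume U: "openin X U"
    have "{\<sigma> \<in> topspace M. \<pi> \<sigma> \<in> U} = S \<inter> (\<Union>i. {\<tau>. \<tau> i \<in> {k. N k \<subseteq> U}})"
    proof (intro equalityI subsetI)
      fix \<sigma> assume "\<sigma> \<in> {\<sigma> \<in> topspace M. \<pi> \<sigma> \<in> U}"
      then have "\<sigma> \<in> S" "\<pi> \<sigma> \<in> U"
        by (auto simp: topM)
      moreover from this obtain i where "N (\<sigma> i) \<subseteq> U"
        using pi[of \<sigma>] U unfolding nbhd_code_def by blast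
      ultimately show "\<sigma> \<in> S \<inter> (\<Union>i. {\<tau>. \<tau> i \<in> {k. N k \<subseteq> U}})"
        by auto
    next
      fix \<sigma> assume "\<sigma> \<in> S \<inter> (\<Union>i. {\<tau>. \<tau> i \<in> {k. N k \<subseteq> U}})"
      then obtain i where i: "\<sigma> \<in> S" "N (\<sigma> i) \<subseteq> U"
        by auto
      then have "\<pi> \<sigma> \<in> N (\<sigma> i)"
        using pi[OF i(1)] unfolding nbhd_code_def by blast
      then show "\<sigma> \<in> {\<sigma> \<in> topspace M. \<pi> \<sigma> \<in> U}"
        using i by (auto simp: topM)
    qed
    moreover have "open (\<Union>i. {\<tau> :: nat \<Rightarrow> nat. \<tau> i \<in> {k. N k \<subseteq> U}})"
      by (intro open_UN ballI open_coordinate)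
    ultimately show "openin M {\<sigma> \<in> topspace M. \<pi> \<sigma> \<in> U}"
      unfolding M_def by (simp add: openin_open_Int)
  qed
  have sub: "subproper_map M X \<pi>"
    unfolding subproper_map_def
  proof (intro conjI exI[of _ "cover_choice N ` topspace X"] allI impI cont)
    show "cover_choice N ` topspace X \<subseteq> topspace M"
      using code by (auto simp: topM S_def)
    show "\<pi> ` cover_choice N ` topspace X = topspace X"
      using pi_eq[OF code] by (simp add: image_image)
    fix K assume K: "precompact_in X K"
    let ?P = "cover_choice N ` topspace X \<inter> {z \<in> topspace M. \<pi> z \<in> K}"
    let ?L = "X closure_of K"
    have L: "compactin X ?L" "K \<subseteq> ?L"
      using K closure_of_subset by (auto simp: precompact_in_def)
    have PL: "?P \<subseteq> cover_choice N ` ?L"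
      using pi_eq[OF code] L(2) by auto
    have clS: "closure ?P \<subseteq> S"
      using closure_mono[OF PL] lim[OF L(1)] unfolding S_def by blast
    have "?P \<subseteq> {\<tau>. \<forall>i. \<tau> i \<in> insert 0 (set_decode i)}"
    proof (intro subsetI CollectI allI)
      fix \<tau> i assume "\<tau> \<in> ?P"
      then obtain x where "\<tau> = cover_choice N x"
        by auto
      then show "\<tau> i \<in> insert 0 (set_decode i)"
        by (simp only: cover_choice_bound)
    qed
    then have "closure ?P \<subseteq> {\<tau>. \<forall>i. \<tau> i \<in> insert 0 (set_decode i)}"
      by (intro closure_minimal closed_coordinatewise)
    then have "compact (closure ?P)"
      using compact_Int_closed[OF compact_bounded_codes closed_closure[of ?P]]
      by (simp only: inf.absorb2)
    moreover have "M closure_of ?P = closure ?P"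
    proof -
      have "?P \<subseteq> S"
        by (auto simp: topM)
      then have "M closure_of ?P = S \<inter> closure ?P"
        by (subst M_def) (simp only: closure_of_subtopology euclidean_closure_of Int_absorb1)
      then show ?thesis
        using clS by (simp only: Int_absorb1)
    qed
    ultimately show "precompact_in M ?P"
      unfolding precompact_in_def using clS by (auto simp: M_def compactin_subtopology)
  qed
  have "second_countable M"
    unfolding M_def by (intro second_countable_subtopology second_countable_euclidean)
  then have "separable_space M"
    by (rule second_countable_imp_separable_space)
  moreover have "metrizable_space M"
    unfolding M_def by (intro metrizable_space_subtopology metrizable_space_sequences)
  ultimately show thesis
    using sub by (intro that)
qed

section \<open>Quotient images of separable metrizable spaces\<close>

text \<open>It suffices to find a point \<open>p\<close> over the limit \<open>l\<close> such that every
  neighbourhood of \<open>p\<close> has an image containing infinitely many terms. If \<open>l\<close> is not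
  repeated infinitely often, the set of the other terms is not closed in \<open>kX\<close>, so its preimage is
  not closed, and any point of the closure outside the preimage will do.\<close>

lemma quotient_map_kification_imp_cs_star_network:
  assumes X: "Hausdorff_space X"
    and f: "quotient_map M (kification X) f"
    and B: "\<And>V. V \<in> \<B> \<Longrightarrow> openin M V"
      "\<And>U x. openin M U \<Longrightarrow> x \<in> U \<Longrightarrow> \<exists>V \<in> \<B>. x \<in> V \<and> V \<subseteq> U"
  shows "is_cs_star_network X ((`) f ` \<B>)"
  unfolding is_cs_star_network_def
proof (intro conjI allI impI)
  have surj: "f ` topspace M = topspace X"
    using f by (simp add: quotient_map_def)
  have cont: "continuous_map M (kification X) f"
    using f by (rule quotient_imp_continuous_map)
  show "(`) f ` \<B> \<subseteq> Pow (topspace X)"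
    using surj openin_subset[OF B(1)] by fastforce
  fix U y l
  assume "openin X U \<and> l \<in> U \<and> range y \<subseteq> topspace X \<and> limitin X y l sequentially"
  then have U: "openin X U" "l \<in> U" and y: "range y \<subseteq> topspace X" "limitin X y l sequentially"
    by auto
  have preU: "openin M {z \<in> topspace M. f z \<in> U}"
    using cont openin_kification_finer[OF U(1)] openin_continuous_map_preimage by blast
  have t1: "t1_space (kification X)"
    using Hausdorff_imp_t1_space[OF Hausdorff_kification[OF X]] .
  have clf: "closedin M {z \<in> topspace M. f z \<in> F}" if "finite F" "F \<subseteq> topspace X" for F
    using closedin_continuous_map_preimage[OF cont] t1_space_closedin_finite[THEN iffD1, OF t1] that
    by simp
  have "\<exists>p \<in> topspace M. f p = l \<and> (\<forall>V. openin M V \<and> p \<in> V \<longrightarrow> infinite {n. y n \<in> f ` V})"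
  proof (cases "infinite {n. y n = l}")
    case True
    have "l \<in> f ` topspace M"
      using U openin_subset surj by blast
    then obtain p where p: "p \<in> topspace M" "f p = l"
      by auto
    have "infinite {n. y n \<in> f ` V}" if "p \<in> V" for V
    proof -
      have "{n. y n = l} \<subseteq> {n. y n \<in> f ` V}"
        using p(2) that by auto
      then show ?thesis
        using True finite_subset by blast
    qed
    then show ?thesis
      using p by blast
  next
    case False
    define A where "A = range y - {l}"
    have AX: "A \<subseteq> topspace X"
      using y(1) by (auto simp: A_def)
    have "\<not> closedin (kification X) A"
    proof
      assume cl: "closedin (kification X) A"
      then have "openin (kification X) (topspace X - A)"
        by (simp add: closedin_def)
      moreover have "l \<in> topspace X - A"
        using limitin_topspace[OF y(2)] by (simp add: A_def)
      ultimately have "finite {n. y n \<notin> topspace X - A}"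
        using y(2) by (intro limitin_imp_finite_outside[of "kification X" y l])
          (simp_all only: limitin_kification)
      moreover have "{n. y n \<notin> topspace X - A} = - {n. y n = l}"
        using y(1) by (auto simp: A_def)
      ultimately have "finite (- {n. y n = l} \<union> {n. y n = l})"
        using False by simp
      then show False
        by (simp add: Un_commute)
    qed
    then have ncl: "\<not> closedin M {z \<in> topspace M. f z \<in> A}"
      using f AX by (simp add: quotient_map_closedin)
    let ?Q = "{z \<in> topspace M. f z \<in> A}"
    have "?Q \<subseteq> topspace M"
      by auto
    then have "\<not> M closure_of ?Q \<subseteq> ?Q"
      using ncl closure_of_subset_eq by metis
    then obtain p where p: "p \<in> M closure_of ?Q" "p \<notin> ?Q"
      by auto
    have pM: "p \<in> topspace M"
      using p(1) by (simp add: in_closure_of)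
    \<comment> \<open>Preimages of finite sets are closed, so a neighbourhood of \<open>p\<close> cannot reach
      the preimage of \<open>A\<close> through finitely many points of \<open>A\<close> only.\<close>
    have inf: "infinite (f ` V \<inter> A)" if V: "openin M V" "p \<in> V" for V
    proof
      assume fin: "finite (f ` V \<inter> A)"
      let ?F = "{z \<in> topspace M. f z \<in> f ` V \<inter> A}"
      have "closedin M ?F"
        using fin AX by (intro clf) auto
      then have o: "openin M (V - ?F)"
        using V(1) by (rule openin_diff[rotated])
      have pV: "p \<in> V - ?F"
        using p(2) V(2) by auto
      have near: "\<forall>T. p \<in> T \<and> openin M T \<longrightarrow> (\<exists>y. y \<in> ?Q \<and> y \<in> T)"
        using p(1) unfolding in_closure_of by (rule conjunct2)
      have "\<exists>z. z \<in> ?Q \<and> z \<in> V - ?F"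
        by (rule near[rule_format]) (intro conjI o pV)
      then show False
        by auto
    qed
    have "f p = l"
    proof (rule ccontr)
      assume ne: "f p \<noteq> l"
      have fpX: "f p \<in> topspace X"
        using pM surj by auto
      then obtain V W where VW: "openin X V" "openin X W" "f p \<in> V" "l \<in> W" "disjnt V W"
        using X ne limitin_topspace[OF y(2)] unfolding Hausdorff_space_def by metis
      have "openin M {z \<in> topspace M. f z \<in> V}"
        using cont openin_kification_finer[OF VW(1)] openin_continuous_map_preimage by blast
      from inf[OF this] have "infinite (f ` {z \<in> topspace M. f z \<in> V} \<inter> A)"
        using pM VW(3) by simp
      moreover have "f ` {z \<in> topspace M. f z \<in> V} \<inter> A \<subseteq> y ` {n. y n \<notin> W}"
        using VW(5) by (auto simp: A_def disjnt_iff)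
      moreover have "finite (y ` {n. y n \<notin> W})"
        using limitin_imp_finite_outside[OF y(2) VW(2,4)] by simp
      ultimately show False
        using finite_subset by blast
    qed
    moreover have "infinite {n. y n \<in> f ` V}" if "openin M V" "p \<in> V" for V
    proof
      assume "finite {n. y n \<in> f ` V}"
      then have "finite (y ` {n. y n \<in> f ` V})"
        by simp
      moreover have "f ` V \<inter> A \<subseteq> y ` {n. y n \<in> f ` V}"
      proof
        fix w assume w: "w \<in> f ` V \<inter> A"
        then obtain n where "w = y n"
          unfolding A_def by blast
        then show "w \<in> y ` {n. y n \<in> f ` V}"
          using w by simp
      qed
      ultimately show False
        using inf[OF that] finite_subset by blast
    qed
    ultimately show ?thesis
      using pM by blast
  qed
  then obtain p where p: "p \<in> topspace M" "f p = l"
    "\<And>V. openin M V \<Longrightarrow> p \<in> V \<Longrightarrow> infinite {n. y n \<in> f ` V}"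
    by blast
  obtain V where V: "V \<in> \<B>" "p \<in> V" "V \<subseteq> {z \<in> topspace M. f z \<in> U}"
    using B(2)[OF preU, of p] p U(2) by auto
  then show "\<exists>N \<in> (`) f ` \<B>. N \<subseteq> U \<and> infinite {n. y n \<in> N}"
    using p(3)[OF B(1)[OF V(1)] V(2)] by (intro bexI[of _ "f ` V"]) auto
qed

section \<open>Separable spaces under the Continuum Hypothesis\<close>

text \<open>Proper initial segments of the cardinal order of the reals have smaller cardinality than the reals,
  so the Continuum Hypothesis makes them countable.\<close>

lemma continuum_hypothesis_wellorder:
  assumes continuum_hypothesis
  obtains R :: "real rel" where "wf R" "\<And>x y. x \<noteq> y \<Longrightarrow> (x, y) \<in> R \<or> (y, x) \<in> R"
    "\<And>x. countable {y. (y, x) \<in> R}"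
proof -
  define r where "r = card_of (UNIV :: real set)"
  have F: "Field r = UNIV" and C: "Card_order r" and W: "well_order_on UNIV r"
    unfolding r_def by (rule Field_card_of card_of_Card_order card_of_well_order_on)+
  have count: "countable {y. (y, x) \<in> r - Id}" for x
  proof -
    have eq: "{y. (y, x) \<in> r - Id} = underS r x"
      by (auto simp: underS_def)
    have less: "(card_of (underS r x), r) \<in> ordLess"
      using F by (intro card_of_underS[OF C]) simp
    have "\<not> underS r x \<approx> (UNIV :: real set)"
    proof
      assume "underS r x \<approx> (UNIV :: real set)"
      then have "(card_of (underS r x), r) \<in> ordIso"
        unfolding eqpoll_def r_def card_of_ordIso .
      then show False
        using less not_ordLess_ordIso by blast
    qed
    then show ?thesis
      using assms unfolding continuum_hypothesis_def eq by blast
  qed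
  show thesis
  proof (rule that)
    show "wf (r - Id)"
      using W by (simp add: well_order_on_def)
    show "(x, y) \<in> r - Id \<or> (y, x) \<in> r - Id" if "x \<noteq> y" for x y
      using W that by (auto simp: well_order_on_def linear_order_on_def total_on_def)
  qed (rule count)
qed

text \<open>Transfinite recursion: at each stage only countably many values have been used.\<close>

lemma continuum_hypothesis_injective_selector:
  fixes e :: "'i \<Rightarrow> real" and A :: "'i \<Rightarrow> 'b set"
  assumes CH: continuum_hypothesis and e: "inj_on e J"
    and A: "\<And>i. i \<in> J \<Longrightarrow> uncountable (A i)"
  shows "\<exists>h. inj_on h J \<and> (\<forall>i \<in> J. h i \<in> A i)"
proof -
  obtain R :: "real rel" where R: "wf R" "\<And>x y. x \<noteq> y \<Longrightarrow> (x, y) \<in> R \<or> (y, x) \<in> R"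
    "\<And>x. countable {y. (y, x) \<in> R}"
    by (rule continuum_hypothesis_wellorder[OF CH]) blast
  define P where "P = (\<lambda>(g :: real \<Rightarrow> 'b) t v.
      t \<in> e ` J \<longrightarrow> v \<in> A (inv_into J e t) - g ` {u. (u, t) \<in> R})"
  have "\<exists>g. \<forall>t. P g t (g t)"
  proof (rule dependent_wf_choice[OF R(1)])
    fix f g :: "real \<Rightarrow> 'b" and t v assume "\<And>u. (u, t) \<in> R \<Longrightarrow> f u = g u"
    then have "f ` {u. (u, t) \<in> R} = g ` {u. (u, t) \<in> R}"
      by (intro image_cong) auto
    then show "P f t v = P g t v"
      by (simp only: P_def)
  next
    fix t and f :: "real \<Rightarrow> 'b"
    show "\<exists>v. P f t v"
    proof (cases "t \<in> e ` J")
      case True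
      then have "uncountable (A (inv_into J e t))"
        by (intro A inv_into_into)
      moreover have "countable (f ` {u. (u, t) \<in> R})"
        using R(3) by (rule countable_image)
      ultimately have "uncountable (A (inv_into J e t) - f ` {u. (u, t) \<in> R})"
        by (rule uncountable_minus_countable)
      then have "A (inv_into J e t) - f ` {u. (u, t) \<in> R} \<noteq> {}"
        by (metis countable_empty)
      then show ?thesis
        unfolding P_def by auto
    qed (simp add: P_def)
  qed
  then obtain g where g: "\<And>t. P g t (g t)"
    by auto
  have h: "g (e i) \<in> A i - g ` {u. (u, e i) \<in> R}" if "i \<in> J" for i
    using g[of "e i"] that e by (simp add: P_def)
  have "inj_on (\<lambda>i. g (e i)) J"
  proof (rule inj_onI, rule ccontr)
    fix i j assume ij: "i \<in> J" "j \<in> J" "g (e i) = g (e j)" "i \<noteq> j"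
    then have "e i \<noteq> e j"
      using e by (auto dest: inj_onD)
    then have "(e i, e j) \<in> R \<or> (e j, e i) \<in> R"
      by (rule R(2))
    then have "g (e i) \<in> g ` {u. (u, e j) \<in> R} \<or> g (e j) \<in> g ` {u. (u, e i) \<in> R}"
      by auto
    then show False
      using h[OF ij(1)] h[OF ij(2)] ij(3) by auto
  qed
  then show ?thesis
    using h by (intro exI[of _ "\<lambda>i. g (e i)"]) auto
qed

lemma countable_Pow_inj_real:
  assumes "countable C"
  obtains e :: "'a set \<Rightarrow> real" where "inj_on e (Pow C)"
proof -
  obtain b :: "nat set \<Rightarrow> real" where "bij_betw b UNIV UNIV"
    using nat_sets_eqpoll_reals unfolding eqpoll_def by blast
  then have b: "inj b"
    by (simp add: bij_betw_def)
  have "inj_on (\<lambda>E. b (to_nat_on C ` E)) (Pow C)"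
  proof (rule inj_onI)
    fix E F assume EF: "E \<in> Pow C" "F \<in> Pow C" "b (to_nat_on C ` E) = b (to_nat_on C ` F)"
    then have "to_nat_on C ` E = to_nat_on C ` F"
      using b by (simp add: inj_eq)
    then show "E = F"
      using inj_on_image_eq_iff[OF inj_on_to_nat_on[OF assms]] EF(1,2) by simp
  qed
  then show thesis
    by (rule that)
qed

text \<open>Index the neighbourhoods \<open>G\<close> of \<open>y\<close> by their traces on a countable dense
  set \<open>C\<close>, which determine their closures. If all neighbourhoods of \<open>y\<close> met
  uncountably many members, then distinct members avoiding \<open>y\<close> could be assigned to distinct traces
  so that each member meets the closure of its trace. Points chosen in these intersections form a closed set,
  because the family is cs-finite. It misses \<open>y\<close> but meets the closure of every neighbourhood of
  \<open>y\<close>.\<close>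

lemma continuum_hypothesis_cs_finite_locally_countable:
  assumes CH: continuum_hypothesis
    and X: "Hausdorff_space X" "regular_space X" "sequential_space X" "separable_space X"
    and A: "cs_finite X \<A>" and y: "y \<in> topspace X"
  shows "\<exists>G. openin X G \<and> y \<in> G \<and> countable {N \<in> \<A>. N \<inter> G \<noteq> {}}"
proof (rule ccontr)
  assume no: "\<not> ?thesis"
  obtain C where C: "countable C" "C \<subseteq> topspace X" "X closure_of C = topspace X"
    using X(4) unfolding separable_space_def by blast
  define J where "J = {G \<inter> C | G. openin X G \<and> y \<in> G}"
  \<comment> \<open>\<open>J\<close> has at most the cardinality of the continuum; the family of all
    neighbourhoods of \<open>y\<close> may be larger.\<close>
  have cl: "X closure_of (G \<inter> C) = X closure_of G" if "openin X G" for G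
    using closure_of_openin_Int_closure_of[OF that, of C] C(3) openin_subset[OF that]
    by (simp add: inf.absorb1)
  obtain e :: "'a set \<Rightarrow> real" where "inj_on e (Pow C)"
    by (rule countable_Pow_inj_real[OF C(1)])
  then have e: "inj_on e J"
    by (rule inj_on_subset) (auto simp: J_def)
  have unc: "uncountable {N \<in> \<A>. y \<notin> N \<and> N \<inter> X closure_of E \<noteq> {}}" if E: "E \<in> J" for E
  proof
    assume count: "countable {N \<in> \<A>. y \<notin> N \<and> N \<inter> X closure_of E \<noteq> {}}"
    obtain G where G: "E = G \<inter> C" "openin X G" "y \<in> G"
      using E unfolding J_def by auto
    have "G \<subseteq> X closure_of E"
      using cl[OF G(2)] closure_of_subset[OF openin_subset[OF G(2)]] G(1) by simp
    then have "{N \<in> \<A>. N \<inter> G \<noteq> {}}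
        \<subseteq> {N \<in> \<A>. y \<notin> N \<and> N \<inter> X closure_of E \<noteq> {}} \<union> {N \<in> \<A>. y \<in> N}"
      by auto
    moreover have "countable {N \<in> \<A>. y \<in> N}"
      by (intro countable_finite cs_finite_point_finite[OF A y])
    ultimately have "countable {N \<in> \<A>. N \<inter> G \<noteq> {}}"
      using count by (meson countable_Un countable_subset)
    then show False
      using no G(2,3) by auto
  qed
  obtain h where h: "inj_on h J"
    "\<And>E. E \<in> J \<Longrightarrow> h E \<in> {N \<in> \<A>. y \<notin> N \<and> N \<inter> X closure_of E \<noteq> {}}"
    using continuum_hypothesis_injective_selector[OF CH e,
        of "\<lambda>E. {N \<in> \<A>. y \<notin> N \<and> N \<inter> X closure_of E \<noteq> {}}"] unc by auto
  have "\<exists>z. z \<in> N \<inter> X closure_of (inv_into J h N)" if "N \<in> h ` J" for N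
  proof -
    have "h (inv_into J h N) = N" "inv_into J h N \<in> J"
      using that by (auto simp: f_inv_into_f inv_into_into)
    then show ?thesis
      using h(2)[of "inv_into J h N"] by auto
  qed
  then obtain g where g: "\<And>N. N \<in> h ` J \<Longrightarrow> g N \<in> N \<inter> X closure_of (inv_into J h N)"
    by metis
  have hA: "h ` J \<subseteq> \<A>"
    using h(2) by auto
  let ?F = "g ` h ` J"
  have "seq_closed_in X ?F"
    using Hausdorff_imp_t1_space[OF X(1)] A hA
    by (rule seq_closed_in_selector) (use g in auto)
  then have "closedin X ?F"
    using X(3) by (simp add: sequential_space_def)
  moreover have "y \<in> topspace X - ?F"
  proof -
    have "y \<noteq> g (h E)" if "E \<in> J" for E
      using g[of "h E"] h(2)[OF that] that by auto
    then show ?thesis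
      using y by auto
  qed
  ultimately obtain G where G: "openin X G" "y \<in> G" "disjnt ?F (X closure_of G)"
    using X(2) unfolding regular_space by metis
  have GJ: "G \<inter> C \<in> J"
    using G(1,2) by (auto simp: J_def)
  then have "g (h (G \<inter> C)) \<in> X closure_of (G \<inter> C)"
    using g[of "h (G \<inter> C)"] h(1) by simp
  then have "g (h (G \<inter> C)) \<in> X closure_of G"
    using cl[OF G(1)] by simp
  moreover have "g (h (G \<inter> C)) \<in> ?F"
    using GJ by simp
  ultimately show False
    using G(3) unfolding disjnt_iff by blast
qed

text \<open>Call \<open>P'\<close> small for the index \<open>k\<close> if its closure has a neighbourhood
  meeting only countably many members of \<open>\<N> k\<close>. Starting from \<open>P \<in> \<N> k\<close>,
  add all \<open>P'\<close> from any \<open>\<N> k'\<close> that are small for \<open>k\<close> and have a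
  closure meeting that of \<open>P\<close>, and continue from each \<open>(k', P')\<close> in the same way. The
  union of the closures is sequentially open, because the members that are small for \<open>k'\<close> still
  form a \<open>cs\<^sup>*\<close>-network. Read backwards, each step admits only countably many predecessors,
  so every point lies in the unions of only countably many starting members, and a countable dense set meets all
  of them.\<close>

lemma locally_countable_cs_star_network_imp_countable:
  fixes \<N> :: "nat \<Rightarrow> 'a set set"
  assumes X: "regular_space X" "sequential_space X" "separable_space X"
    and N: "is_cs_star_network X (\<Union>m. \<N> m)"
    and loc: "\<And>m y. y \<in> topspace X \<Longrightarrow>
      \<exists>G. openin X G \<and> y \<in> G \<and> countable {N \<in> \<N> m. N \<inter> G \<noteq> {}}"
  shows "countable (\<N> m)"
proof -
  have NX: "P \<subseteq> topspace X" if "P \<in> \<N> k" for P k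
  proof -
    have "(\<Union>m. \<N> m) \<subseteq> Pow (topspace X)"
      using N unfolding is_cs_star_network_def by (rule conjunct1)
    then show ?thesis
      using that by auto
  qed
  have meets: "P \<inter> G \<noteq> {}" if "z \<in> X closure_of P" "z \<in> G" "openin X G" for z P G
  proof -
    have "\<forall>T. z \<in> T \<and> openin X T \<longrightarrow> (\<exists>w. w \<in> P \<and> w \<in> T)"
      using that(1) unfolding in_closure_of by (rule conjunct2)
    from this[rule_format, of G] show ?thesis
      using that(2,3) by auto
  qed
  define small where "small = (\<lambda>k P. \<exists>G. openin X G \<and> X closure_of P \<subseteq> G \<and>
      countable {N \<in> \<N> k. N \<inter> G \<noteq> {}})"
  define T where "T = {((k, P), (k', P')). P \<in> \<N> k \<and> P' \<in> \<N> k' \<and> small k P' \<and>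
      X closure_of P \<inter> X closure_of P' \<noteq> {}}"
  define V where "V = (\<lambda>q. \<Union>(k, P) \<in> T\<^sup>* `` {q}. X closure_of P)"
  have preds: "countable (T\<inverse> `` {(k', P')})" for k' P'
  proof -
    have "countable {P \<in> \<N> k. small k P' \<and> X closure_of P \<inter> X closure_of P' \<noteq> {}}" for k
    proof (cases "small k P'")
      case True
      then obtain G where G: "openin X G" "X closure_of P' \<subseteq> G" "countable {N \<in> \<N> k. N \<inter> G \<noteq> {}}"
        unfolding small_def by auto
      have "{P \<in> \<N> k. small k P' \<and> X closure_of P \<inter> X closure_of P' \<noteq> {}}
          \<subseteq> {N \<in> \<N> k. N \<inter> G \<noteq> {}}"
      proof
        fix P assume P: "P \<in> {P \<in> \<N> k. small k P' \<and> X closure_of P \<inter> X closure_of P' \<noteq> {}}"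
        then obtain z where "z \<in> X closure_of P" "z \<in> X closure_of P'"
          by auto
        then have "P \<inter> G \<noteq> {}"
          using G(1,2) by (intro meets) auto
        then show "P \<in> {N \<in> \<N> k. N \<inter> G \<noteq> {}}"
          using P by auto
      qed
      then show ?thesis
        using G(3) by (rule countable_subset)
    qed simp
    then have "countable (SIGMA k : UNIV. {P \<in> \<N> k. small k P' \<and> X closure_of P \<inter> X closure_of P' \<noteq> {}})"
      by (intro countable_SIGMA) auto
    moreover have "T\<inverse> `` {(k', P')}
        \<subseteq> (SIGMA k : UNIV. {P \<in> \<N> k. small k P' \<and> X closure_of P \<inter> X closure_of P' \<noteq> {}})"
      by (auto simp: T_def)
    ultimately show ?thesis
      by (rule countable_subset[rotated])
  qed
  have preds_star: "countable ((T\<inverse>)\<^sup>* `` S)" if "countable S" for S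
  proof (rule countable_rtrancl[OF _ that])
    fix Q :: "(nat \<times> 'a set) set" assume Q: "countable Q"
    have "T\<inverse> `` Q = (\<Union>q \<in> Q. T\<inverse> `` {q})"
      by auto
    also have "countable \<dots>"
      using Q preds by (intro countable_UN) auto
    finally show "countable (T\<inverse> `` Q)" .
  qed
  have reach: "P' \<in> \<N> k'" if "((k, P), (k', P')) \<in> T\<^sup>*" "P \<in> \<N> k" for k P k' P'
    using that(1)
  proof (cases rule: rtranclE)
    case base
    then show ?thesis
      using that(2) by simp
  next
    case (step q)
    then show ?thesis
      by (auto simp: T_def)
  qed
  have openV: "openin X (V (k, P))" if P: "P \<in> \<N> k" for k P
  proof -
    have VX: "V (k, P) \<subseteq> topspace X"
      unfolding V_def using closure_of_subset_topspace by fastforce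
    have "seq_closed_in X (topspace X - V (k, P))"
      unfolding seq_closed_in_def
    proof (intro conjI allI impI)
      fix x l assume *: "range x \<subseteq> topspace X - V (k, P) \<and> limitin X x l sequentially"
      then have lim: "limitin X x l sequentially" and xX: "range x \<subseteq> topspace X"
        by auto
      have xV: "x n \<notin> V (k, P)" for n
        using * by auto
      have l: "l \<in> topspace X"
        using limitin_topspace[OF lim] .
      have "l \<notin> V (k, P)"
      proof
        assume "l \<in> V (k, P)"
        then obtain k' P' where kP': "((k, P), (k', P')) \<in> T\<^sup>*" "l \<in> X closure_of P'"
          unfolding V_def by auto
        obtain G where G: "openin X G" "l \<in> G" "countable {N \<in> \<N> k'. N \<inter> G \<noteq> {}}"
          using loc[OF l, of k'] by auto
        have "closedin X (topspace X - G)" "l \<in> topspace X - (topspace X - G)"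
          using G(1,2) l by auto
        then obtain W where W: "openin X W" "l \<in> W" "disjnt (topspace X - G) (X closure_of W)"
          using X(1) unfolding regular_space by metis
        have clW: "X closure_of W \<subseteq> G"
          using W(3) closure_of_subset_topspace[of X W] by (auto simp: disjnt_iff)
        \<comment> \<open>Taking \<open>Q\<close> inside \<open>W\<close> rather than \<open>G\<close> keeps its
          closure inside \<open>G\<close>, so that \<open>Q\<close> is small for the index of
          \<open>P'\<close>.\<close>
        obtain Q where Q: "Q \<in> (\<Union>m. \<N> m)" "Q \<subseteq> W" "infinite {n. x n \<in> Q}"
          using is_cs_star_networkD[OF N W(1,2) xX lim] by auto
        then obtain k'' where k'': "Q \<in> \<N> k''"
          by auto
        have "l \<in> X closure_of Q"
          unfolding in_closure_of
        proof (intro conjI allI impI l)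
          fix B assume B: "l \<in> B \<and> openin X B"
          have "finite {n. x n \<notin> B}"
            using limitin_imp_finite_outside[OF lim] B by blast
          then have "infinite ({n. x n \<in> Q} - {n. x n \<notin> B})"
            using Q(3) by (rule Diff_infinite_finite)
          then have "{n. x n \<in> Q} - {n. x n \<notin> B} \<noteq> {}"
            by (metis finite.emptyI)
          then show "\<exists>y. y \<in> Q \<and> y \<in> B"
            by auto
        qed
        moreover have "small k' Q"
          unfolding small_def using G closure_of_mono[OF Q(2), of X] clW by (intro exI[of _ G]) auto
        ultimately have "((k', P'), (k'', Q)) \<in> T"
          using kP' k'' reach[OF kP'(1) P] by (auto simp: T_def)
        then have "((k, P), (k'', Q)) \<in> T\<^sup>*"
          using kP'(1) by (rule rtrancl_into_rtrancl[rotated])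
        then have "X closure_of Q \<subseteq> V (k, P)"
          unfolding V_def by auto
        moreover have "Q \<subseteq> X closure_of Q"
          using NX[OF k''] by (rule closure_of_subset)
        ultimately have "{n. x n \<in> Q} = {}"
          using xV by auto
        then show False
          using Q(3) by simp
      qed
      then show "l \<in> topspace X - V (k, P)"
        using l by simp
    qed auto
    then have "closedin X (topspace X - V (k, P))"
      using X(2) by (simp add: sequential_space_def)
    then show ?thesis
      using VX by (simp add: openin_closedin_eq)
  qed
  obtain C where C: "countable C" "C \<subseteq> topspace X" "X closure_of C = topspace X"
    using X(3) unfolding separable_space_def by blast
  have "\<N> m \<subseteq> insert {} (\<Union>c \<in> C. {P \<in> \<N> m. c \<in> V (m, P)})"
  proof
    fix P assume P: "P \<in> \<N> m"
    show "P \<in> insert {} (\<Union>c \<in> C. {P \<in> \<N> m. c \<in> V (m, P)})"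
    proof (cases "P = {}")
      case False
      then obtain z where z: "z \<in> P"
        by auto
      have "z \<in> X closure_of P"
        using closure_of_subset[OF NX[OF P]] z by auto
      then have "z \<in> V (m, P)"
        unfolding V_def by auto
      moreover have "z \<in> X closure_of C"
        using C(3) NX[OF P] z by auto
      ultimately have "C \<inter> V (m, P) \<noteq> {}"
        using openV[OF P] by (intro meets)
      then show ?thesis
        using P by auto
    qed simp
  qed
  moreover have "countable {P \<in> \<N> m. c \<in> V (m, P)}" if c: "c \<in> C" for c
  proof -
    have cX: "c \<in> topspace X"
      using c C(2) by auto
    have "countable {P \<in> \<N> k. c \<in> X closure_of P}" for k
    proof -
      obtain G where G: "openin X G" "c \<in> G" "countable {N \<in> \<N> k. N \<inter> G \<noteq> {}}"
        using loc[OF cX, of k] by auto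
      have "{P \<in> \<N> k. c \<in> X closure_of P} \<subseteq> {N \<in> \<N> k. N \<inter> G \<noteq> {}}"
        using meets[OF _ G(2,1)] by auto
      then show ?thesis
        using G(3) by (rule countable_subset)
    qed
    then have "countable (SIGMA k : UNIV. {P \<in> \<N> k. c \<in> X closure_of P})"
      by (intro countable_SIGMA) auto
    then have "countable (snd ` ((T\<inverse>)\<^sup>* `` (SIGMA k : UNIV. {P \<in> \<N> k. c \<in> X closure_of P})))"
      by (intro countable_image preds_star)
    moreover have "{P \<in> \<N> m. c \<in> V (m, P)}
        \<subseteq> snd ` ((T\<inverse>)\<^sup>* `` (SIGMA k : UNIV. {P \<in> \<N> k. c \<in> X closure_of P}))"
    proof
      fix P assume P: "P \<in> {P \<in> \<N> m. c \<in> V (m, P)}"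
      then obtain k' P' where kP': "((m, P), (k', P')) \<in> T\<^sup>*" "c \<in> X closure_of P'"
        unfolding V_def by auto
      then have "((k', P'), (m, P)) \<in> (T\<inverse>)\<^sup>*"
        by (simp add: rtrancl_converse)
      moreover have "P' \<in> \<N> k'"
        using reach[OF kP'(1)] P by simp
      ultimately have "(m, P) \<in> (T\<inverse>)\<^sup>* `` (SIGMA k : UNIV. {P \<in> \<N> k. c \<in> X closure_of P})"
        using kP'(2) by auto
      then show "P \<in> snd ` ((T\<inverse>)\<^sup>* `` (SIGMA k : UNIV. {P \<in> \<N> k. c \<in> X closure_of P}))"
        by (rule image_eqI[rotated]) simp
    qed
    ultimately show ?thesis
      by (rule countable_subset[rotated])
  qed
  then have "countable (insert {} (\<Union>c \<in> C. {P \<in> \<N> m. c \<in> V (m, P)}))"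
    using C(1) by (intro countable_insert countable_UN) auto
  ultimately show ?thesis
    by (rule countable_subset)
qed

section \<open>The equivalences\<close>

lemma cs_star_network_of_seq_coreflexion:
  assumes "is_cs_star_network (seq_coreflexion X) \<N>"
  shows "is_cs_star_network X \<N>"
  unfolding is_cs_star_network_def
proof (intro conjI allI impI)
  show "\<N> \<subseteq> Pow (topspace X)"
    using assms unfolding is_cs_star_network_def topspace_seq_coreflexion by (rule conjunct1)
  fix U x l
  assume "openin X U \<and> l \<in> U \<and> range x \<subseteq> topspace X \<and> limitin X x l sequentially"
  then show "\<exists>N \<in> \<N>. N \<subseteq> U \<and> infinite {n. x n \<in> N}"
    by (intro is_cs_star_networkD[OF assms, of U l x])
      (simp_all add: openin_seq_coreflexion_finer limitin_seq_coreflexion)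
qed

text \<open>The common end of two arguments, which differ in why the cs-finite families of \<open>sX\<close> are
  countable: countable extent in one case, separability and the Continuum Hypothesis in the other.\<close>

lemma sigma_countable_network_imp_aleph0_space:
  assumes X: "Hausdorff_space X" "regular_space X"
    and cs: "cs_star_metrizable (seq_coreflexion X)"
    and count: "\<And>\<N> m. (\<And>m. cs_finite (seq_coreflexion X) (\<N> m)) \<Longrightarrow>
      is_cs_star_network (seq_coreflexion X) (\<Union>m. \<N> m) \<Longrightarrow> countable (\<N> (m :: nat))"
  shows "aleph0_space X"
proof -
  obtain \<N> :: "nat \<Rightarrow> 'a set set" where
    N: "\<And>m. cs_finite (seq_coreflexion X) (\<N> m)" "is_cs_star_network (seq_coreflexion X) (\<Union>m. \<N> m)"
    using cs_star_metrizable_imp_sigma_cs_finite_network[OF cs] by auto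
  have "countable (\<Union>m. \<N> m)"
    by (intro countable_UN count N) auto
  then show ?thesis
    using cs_star_network_of_seq_coreflexion[OF N(2)]
    by (rule countable_cs_star_network_imp_aleph0_space[OF X])
qed

theorem theorem7p2:
  fixes X :: "'a topology"
  assumes "Hausdorff_space X" and "regular_space X"
  shows
    "(aleph0_space X \<longleftrightarrow>
        (\<exists>(M :: (nat \<Rightarrow> nat) topology) \<pi>.
           metrizable_space M \<and> separable_space M \<and>
           subproper_map M X \<pi> \<and> \<pi> ` topspace M = topspace X)) \<and>
     (aleph0_space X \<longleftrightarrow> k_star_metrizable X \<and> has_countable_network X) \<and>
     (aleph0_space X \<longleftrightarrow> cs_star_metrizable X \<and> has_countable_network X) \<and>
     (aleph0_space X \<longleftrightarrow>
        k_star_metrizable (kification X) \<and> countable_extent (kification X)) \<and>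
     (aleph0_space X \<longleftrightarrow>
        cs_star_metrizable (seq_coreflexion X) \<and> countable_extent (seq_coreflexion X)) \<and>
     (aleph0_space X \<longleftrightarrow>
        (\<exists>(M :: (nat \<Rightarrow> nat) topology) f.
           metrizable_space M \<and> separable_space M \<and> quotient_map M (kification X) f)) \<and>
     (regular_space (seq_coreflexion X) \<and> continuum_hypothesis \<longrightarrow>
        (aleph0_space X \<longleftrightarrow>
           separable_space (seq_coreflexion X) \<and> cs_star_metrizable (seq_coreflexion X)))"
proof -
  let ?sX = "seq_coreflexion X" and ?kX = "kification X"
  have X: "Hausdorff_space X" "regular_space X"
    by (rule assms)+
  have HsX: "Hausdorff_space ?sX" and HkX: "Hausdorff_space ?kX"
    using X(1) by (simp_all add: Hausdorff_seq_coreflexion Hausdorff_kification)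
  let ?P2 = "\<exists>(M :: (nat \<Rightarrow> nat) topology) \<pi>.
           metrizable_space M \<and> separable_space M \<and>
           subproper_map M X \<pi> \<and> \<pi> ` topspace M = topspace X"
  let ?P7 = "\<exists>(M :: (nat \<Rightarrow> nat) topology) f.
           metrizable_space M \<and> separable_space M \<and> quotient_map M ?kX f"
  have 12: "?P2" if a0: "aleph0_space X"
  proof -
    obtain M :: "(nat \<Rightarrow> nat) topology" and \<pi> where
      "metrizable_space M" "separable_space M" "subproper_map M X \<pi>"
      by (rule aleph0_space_imp_subproper_image[OF a0])
    then show ?thesis
      using subproper_map_imp_surjective_map by blast
  qed
  have 2: "k_star_metrizable X \<and> has_countable_network X \<and> k_star_metrizable ?kX \<and> ?P7 \<and>
      separable_space ?sX" if p2: ?P2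
  proof -
    obtain M :: "(nat \<Rightarrow> nat) topology" and \<pi> where
      M: "metrizable_space M" "separable_space M" and \<pi>: "subproper_map M X \<pi>"
        "\<pi> ` topspace M = topspace X"
      using p2 by auto
    have cont: "continuous_map M X \<pi>"
      using \<pi>(1) by (simp add: subproper_map_def)
    have "k_star_metrizable X"
      by (rule k_star_metrizableI[OF X(1) M(1) \<pi>(1)])
    moreover have "has_countable_network X"
      by (rule second_countable_image_has_countable_network
          [OF metrizable_separable_imp_second_countable[OF M] cont \<pi>(2)])
    moreover have "k_star_metrizable ?kX"
      by (rule k_star_metrizableI[OF HkX M(1) subproper_map_into_kification[OF X(1) M(1) \<pi>(1)]])
    moreover have "quotient_map M ?kX \<pi>"
      by (rule subproper_map_imp_quotient_map_kification[OF X(1) M(1) \<pi>(1)])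
    moreover have "separable_space ?sX"
    proof (rule separable_space_continuous_map_image[OF M(2)])
      show "continuous_map M ?sX \<pi>"
        by (rule continuous_map_into_seq_coreflexion[OF metrizable_imp_sequential_space[OF M(1)] cont])
      show "\<pi> ` topspace M = topspace ?sX"
        using \<pi>(2) by simp
    qed
    ultimately show ?thesis
      using M by auto
  qed
  have 34: "cs_star_metrizable X" if "k_star_metrizable X"
    by (rule k_star_metrizable_imp_cs_star_metrizable[OF that])
  have 46: "cs_star_metrizable ?sX" "countable_extent ?sX"
    if "cs_star_metrizable X" "has_countable_network X"
    using cs_star_metrizable_seq_coreflexion[OF that(1)] countable_extent_seq_coreflexion[OF that(2)]
    by auto
  have 61: "aleph0_space X" if "cs_star_metrizable ?sX" "countable_extent ?sX"
  proof (rule sigma_countable_network_imp_aleph0_space[OF X that(1)])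
    fix \<N> :: "nat \<Rightarrow> 'a set set" and m assume "\<And>m. cs_finite ?sX (\<N> m)"
    then show "countable (\<N> m)"
      by (rule countable_extent_imp_countable_cs_finite[OF sequential_space_seq_coreflexion
            Hausdorff_imp_t1_space[OF HsX] that(2)])
  qed
  have k_eq: "?kX = ?sX" if "k_star_metrizable ?kX"
    by (rule k_star_metrizable_imp_kification_eq_seq_coreflexion[OF X(1) that])
  have 56: "cs_star_metrizable ?sX" "countable_extent ?sX"
    if "k_star_metrizable ?kX" "countable_extent ?kX"
    using k_star_metrizable_imp_cs_star_metrizable[OF that(1)] that(2) unfolding k_eq[OF that(1)]
    by auto
  have 71: "aleph0_space X" if p7: ?P7
  proof -
    obtain M :: "(nat \<Rightarrow> nat) topology" and f where
      M: "metrizable_space M" "separable_space M" and f: "quotient_map M ?kX f"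
      using p7 by auto
    obtain \<B> where B: "countable \<B>" "\<And>V. V \<in> \<B> \<Longrightarrow> openin M V"
      "\<And>U x. openin M U \<Longrightarrow> x \<in> U \<Longrightarrow> \<exists>V \<in> \<B>. x \<in> V \<and> V \<subseteq> U"
      using metrizable_separable_imp_second_countable[OF M] unfolding second_countable_def by auto
    have "countable ((`) f ` \<B>)"
      using B(1) by (rule countable_image)
    moreover have "is_cs_star_network X ((`) f ` \<B>)"
      by (rule quotient_map_kification_imp_cs_star_network[OF X(1) f B(2,3)])
    ultimately show ?thesis
      by (rule countable_cs_star_network_imp_aleph0_space[OF X])
  qed
  have 81: "aleph0_space X"
    if reg: "regular_space ?sX" and CH: continuum_hypothesis
      and sep: "separable_space ?sX" and cs: "cs_star_metrizable ?sX"
  proof (rule sigma_countable_network_imp_aleph0_space[OF X cs])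
    fix \<N> :: "nat \<Rightarrow> 'a set set" and m
    assume N: "\<And>m. cs_finite ?sX (\<N> m)" "is_cs_star_network ?sX (\<Union>m. \<N> m)"
    show "countable (\<N> m)"
      by (rule locally_countable_cs_star_network_imp_countable
          [OF reg sequential_space_seq_coreflexion sep N(2)])
        (rule continuum_hypothesis_cs_finite_locally_countable
          [OF CH HsX reg sequential_space_seq_coreflexion sep N(1)])
  qed
  have e2: "aleph0_space X \<longleftrightarrow> ?P2" and e3: "aleph0_space X \<longleftrightarrow> k_star_metrizable X \<and> has_countable_network X"
    and e4: "aleph0_space X \<longleftrightarrow> cs_star_metrizable X \<and> has_countable_network X"
    and e6: "aleph0_space X \<longleftrightarrow> cs_star_metrizable ?sX \<and> countable_extent ?sX"
    using 12 2 34 46 61 by metis+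
  have e5: "aleph0_space X \<longleftrightarrow> k_star_metrizable ?kX \<and> countable_extent ?kX"
    using e2 2 e6 56 k_eq by metis
  have e7: "aleph0_space X \<longleftrightarrow> ?P7"
    using e2 2 71 by metis
  have e8: "regular_space ?sX \<and> continuum_hypothesis \<longrightarrow>
      (aleph0_space X \<longleftrightarrow> separable_space ?sX \<and> cs_star_metrizable ?sX)"
    using e2 2 e6 81 by metis
  show ?thesis
    by (intro conjI e2 e3 e4 e5 e6 e7 e8)
qed

end
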